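(* Let $n\ge1$ and $m<0$. Suppose that $\sigma:\mathbb{R}^n\times\mathbb{N}_0^n\to\mathbb{C}$ (with $\sigma(\cdot,\xi)$ measurable for each $\xi$) satisfies: for every multi-index $\kappa\in\mathbb{N}_0^n$ with $|\kappa|\le\lfloor n/2\rfloor+1$ there is a constant $C_\kappa$ such that $$\big\Vert\triangle_\xi^\kappa\sigma(\cdot,\xi)\big\Vert_{L^\infty(\mathbb{R}^n)}\le C_\kappa\,\langle\xi\rangle^{\frac{m}{2}-|\kappa|}\qquad\text{for all }\xi\in\mathbb{N}_0^n .$$ Then the Hermite pseudo-multiplier $\sigma(\cdot,\mathcal{L})$ extends to a bounded operator on $L^2(\mathbb{R}^n)$.
   Context: $\mathbb{N}_0=\{0,1,2,\dots\}$; for $\xi\in\mathbb{N}_0^n$, $|\xi|=\xi_1+\dots+\xi_n$ and $\langle\xi\rangle=1+|\xi|$. Hermite functions: for $k\in\mathbb{N}_0$, $H_k(t)=(-1)^k e^{t^2}\partial_t^k(e^{-t^2})$ and $h_k(t)=(2^kk!\sqrt{\pi})^{-1/2}H_k(t)e^{-t^2/2}$, $t\in\mathbb{R}$; for $\xi\in\mathbb{N}_0^n$, $h_\xi(x)=\prod_{j=1}^n h_{\xi_j}(x_j)$, $x\in\mathbb{R}^n$. The family $\{h_\xi\}_{\xi\in\mathbb{N}_0^n}$ is an orthonormal basis of $L^2(\mathbb{R}^n)$ of eigenfunctions of $\mathcal{L}=-\Delta+|x|^2$. Finite differences: for $g$ defined on $\mathbb{N}_0^n$, $\triangle_i g(\xi)=g(\xi+e_i)-g(\xi)$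 ($e_i$ the $i$-th standard basis vector), $\triangle_i^\ell g=\triangle_i(\triangle_i^{\ell-1}g)$ for $\ell\ge2$, and $\triangle_\xi^\kappa=\triangle_1^{\kappa_1}\cdots\triangle_n^{\kappa_n}$, acting in the variable $\xi$. Hermite pseudo-multiplier with symbol $\sigma$: $\sigma(x,\mathcal{L})f(x)=\sum_{\xi\in\mathbb{N}_0^n}\sigma(x,\xi)\langle f,h_\xi\rangle h_\xi(x)$, where $\langle f,h_\xi\rangle=\int_{\mathbb{R}^n}f h_\xi\,dx$; it is initially defined on finite linear combinations of Hermite functions. *)

theory Defs
  imports "HOL-Probability.Essential_Supremum"
begin

section \<open>Multi-indices and finite differences\<close>

definition mi_abs :: "nat ^ 'n \<Rightarrow> nat" where
  "mi_abs \<xi> = (\<Sum>i\<in>UNIV. \<xi> $ i)"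

definition mi_bracket :: "nat ^ 'n \<Rightarrow> real" where
  "mi_bracket \<xi> = 1 + real (mi_abs \<xi>)"

definition fdiff :: "'n \<Rightarrow> (nat ^ 'n \<Rightarrow> complex) \<Rightarrow> nat ^ 'n \<Rightarrow> complex" where
  "fdiff i g = (\<lambda>\<xi>. g (\<xi> + axis i 1) - g \<xi>)"

text \<open>
  The composition of the operators \<open>fdiff i ^^ (\<kappa> $ i)\<close> over all coordinates \<open>i\<close>. These operators
  commute (\<open>comp_fun_commute_fdiff\<close>), so the fold does not depend on the order of the coordinates.
\<close>

definition mfdiff :: "nat ^ 'n \<Rightarrow> (nat ^ 'n \<Rightarrow> complex) \<Rightarrow> nat ^ 'n \<Rightarrow> complex" where
  "mfdiff \<kappa> g = Finite_Set.fold (\<lambda>i. fdiff i ^^ (\<kappa> $ i)) g UNIV"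

lemma fdiff_commute: "fdiff i (fdiff j g) = fdiff j (fdiff i g)"
  by (simp add: fdiff_def fun_eq_iff add.left_commute add.commute)

lemma fdiff_funpow_commute:
  "(fdiff i ^^ a) ((fdiff j ^^ b) g) = (fdiff j ^^ b) ((fdiff i ^^ a) g)"
proof -
  have *: "fdiff i ((fdiff j ^^ b) g) = (fdiff j ^^ b) (fdiff i g)" for g
    by (induction b) (simp_all add: fdiff_commute[of i j])
  show ?thesis
    by (induction a) (simp_all add: *)
qed

lemma comp_fun_commute_fdiff: "comp_fun_commute (\<lambda>i. fdiff i ^^ (\<kappa> $ i))"
  by unfold_locales (simp add: fun_eq_iff fdiff_funpow_commute)


section \<open>Hermite functions\<close>

definition hermite_poly :: "nat \<Rightarrow> real \<Rightarrow> real" where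
  "hermite_poly k t = (-1) ^ k * exp (t\<^sup>2) * (deriv ^^ k) (\<lambda>s. exp (- (s\<^sup>2))) t"

definition hermite_fun1 :: "nat \<Rightarrow> real \<Rightarrow> real" where
  "hermite_fun1 k t =
     (2 ^ k * fact k * sqrt pi) powr (- 1 / 2) * hermite_poly k t * exp (- (t\<^sup>2) / 2)"

definition hermite_fun :: "nat ^ 'n \<Rightarrow> real ^ 'n \<Rightarrow> real" where
  "hermite_fun \<xi> x = (\<Prod>j\<in>UNIV. hermite_fun1 (\<xi> $ j) (x $ j))"

definition hermite_span :: "(real ^ 'n \<Rightarrow> complex) set" where
  "hermite_span =
     {f. \<exists>A c. finite A \<and> f = (\<lambda>x. \<Sum>\<xi>\<in>A. c \<xi> * complex_of_real (hermite_fun \<xi> x))}"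

definition hermite_coeff :: "(real ^ 'n \<Rightarrow> complex) \<Rightarrow> nat ^ 'n \<Rightarrow> complex" where
  "hermite_coeff f \<xi> = (LINT x|lebesgue. f x * complex_of_real (hermite_fun \<xi> x))"

text \<open>
  On \<open>hermite_span\<close> only finitely many coefficients are nonzero, so there the sum is a finite sum
  at every point.
\<close>

definition pseudo_mult ::
    "(real ^ 'n \<Rightarrow> nat ^ 'n \<Rightarrow> complex) \<Rightarrow> (real ^ 'n \<Rightarrow> complex) \<Rightarrow> real ^ 'n \<Rightarrow> complex" where
  "pseudo_mult \<sigma> f =
     (\<lambda>x. \<Sum>\<^sub>\<infinity>\<xi>\<in>UNIV. \<sigma> x \<xi> * hermite_coeff f \<xi> * complex_of_real (hermite_fun \<xi> x))"


section \<open>Lebesgue norms and bounded operators on square-integrable functions\<close>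

definition Linf_norm :: "(real ^ 'n \<Rightarrow> complex) \<Rightarrow> ereal" where
  "Linf_norm f = esssup lebesgue (\<lambda>x. ereal (norm (f x)))"

definition L2 :: "(real ^ 'n \<Rightarrow> complex) set" where
  "L2 = {f \<in> borel_measurable lebesgue. integrable lebesgue (\<lambda>x. (norm (f x))\<^sup>2)}"

definition L2_norm :: "(real ^ 'n \<Rightarrow> complex) \<Rightarrow> real" where
  "L2_norm f = sqrt (LINT x|lebesgue. (norm (f x))\<^sup>2)"

text \<open>
  Elements of \<open>L2\<close> are functions rather than almost-everywhere classes, so linearity is required up
  to null sets. Together with the norm bound, this makes \<open>T\<close> respect almost-everywhere equality.
\<close>

definition bounded_operator_L2 ::
    "((real ^ 'n \<Rightarrow> complex) \<Rightarrow> real ^ 'n \<Rightarrow> complex) \<Rightarrow> bool" where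
  "bounded_operator_L2 T \<longleftrightarrow>
     (\<forall>f\<in>L2. T f \<in> L2) \<and>
     (\<forall>f\<in>L2. \<forall>g\<in>L2. AE x in lebesgue. T (\<lambda>y. f y + g y) x = T f x + T g x) \<and>
     (\<forall>c. \<forall>f\<in>L2. AE x in lebesgue. T (\<lambda>y. c * f y) x = c * T f x) \<and>
     (\<exists>K. \<forall>f\<in>L2. L2_norm (T f) \<le> K * L2_norm f)"

definition extends_to_bounded_operator_L2 ::
    "(real ^ 'n \<Rightarrow> complex) set \<Rightarrow> ((real ^ 'n \<Rightarrow> complex) \<Rightarrow> real ^ 'n \<Rightarrow> complex) \<Rightarrow> bool" where
  "extends_to_bounded_operator_L2 D A \<longleftrightarrow>
     (\<exists>T. bounded_operator_L2 T \<and> (\<forall>f\<in>D. AE x in lebesgue. T f x = A f x))"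

end

theory Submission
  imports Defs "HOL-Probability.Distributions" "HOL-Computational_Algebra.Polynomial"
begin

text \<open>
  Write \<open>n\<close> for the dimension and \<open>N = n div 2 + 1\<close>. The symbol is split into pieces supported where
  \<open>|\<xi>|\<close> is comparable to \<open>2\<^sup>j\<close>. The operator of the \<open>j\<close>-th piece has \<open>L2\<close> norm at most a constant times
  \<open>2 powr (j m / 2)\<close>, and since \<open>m < 0\<close> these norms sum. Each piece is a finite sum of rank-one terms
  defined on all of \<open>L2\<close>, so the sum of the pieces is a bounded operator on \<open>L2\<close> that agrees with the
  pseudo-multiplier on the span of the Hermite functions.

  A piece at frequency \<open>|\<xi>| \<le> Q\<close> is an integral operator with kernel
  \<open>K(x, y) = \<Sum>\<^sub>\<xi> a(x, \<xi>) h\<^sub>\<xi>(x) h\<^sub>\<xi>(y)\<close>. As the symbol depends on \<open>x\<close>, orthogonality is available only in the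
  variable \<open>y\<close>, for fixed \<open>x\<close>. It is exploited through the weighted norms

    \<open>\<integral> |K(x, y)|\<^sup>2 (1 + Q\<^sup>N \<Sum>\<^sub>i |x\<^sub>i - y\<^sub>i|\<^sup>2\<^sup>N) dy \<le> C M\<^sup>2 Q powr (n / 2)\<close>

  (\<open>kernel_weighted_L2\<close>), where \<open>M\<close> bounds the differences of \<open>a\<close> at scale \<open>Q\<close>. Because \<open>2 N > n\<close>, the reciprocal
  of the weight is integrable, with integral of order \<open>Q powr (- n / 2)\<close>; the Cauchy-Schwarz inequality and
  Tonelli's theorem then bound the operator norm by a multiple of \<open>M\<close>, uniformly in \<open>Q\<close>
  (\<open>pseudo_mult_piece_bound\<close>).

  The weighted norms rest on two facts. First, multiplication by \<open>x\<^sub>i - y\<^sub>i\<close> turns the symbol into its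
  difference \<open>\<triangle>\<^sub>i\<close>, at the cost of one raising operator, or removes such an operator
  (\<open>mult_ladder_kernel\<close>). This follows from the ladder relation for \<open>x\<^sub>i h\<^sub>\<xi>\<close>, the commutator of raising and
  lowering, and summation by parts. Second, \<open>\<Sum>\<^bsub>|\<xi>| \<le> Q\<^esub> h\<^sub>\<xi>(x)\<^sup>2\<close> is at most a multiple of \<open>Q powr (n / 2)\<close>
  (\<open>spectral_diag_le\<close>), which reduces to one dimension, where the derivative of the sum telescopes
  (\<open>sum_hermite_fun1_square_le\<close>).
\<close>

section \<open>Hermite functions on the line\<close>

fun herm :: "nat \<Rightarrow> real poly" where
  "herm 0 = 1"
| "herm (Suc k) = [:0, 2:] * herm k - pderiv (herm k)"

lemma deriv_gauss_funpow:
  "(deriv ^^ k) (\<lambda>s::real. exp (- (s\<^sup>2))) = (\<lambda>s. (-1) ^ k * poly (herm k) s * exp (- (s\<^sup>2)))"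
proof (induction k)
  case (Suc k)
  have "((\<lambda>s. (-1) ^ k * poly (herm k) s * exp (- (s\<^sup>2))) has_real_derivative
          (-1) ^ Suc k * poly (herm (Suc k)) s * exp (- (s\<^sup>2))) (at s)" for s
    by (auto intro!: derivative_eq_intros poly_DERIV simp: algebra_simps)
  then have "deriv (\<lambda>s. (-1) ^ k * poly (herm k) s * exp (- (s\<^sup>2))) =
      (\<lambda>s. (-1) ^ Suc k * poly (herm (Suc k)) s * exp (- (s\<^sup>2)))"
    by (intro ext DERIV_imp_deriv)
  with Suc show ?case
    by simp
qed simp

lemma hermite_poly_eq_herm: "hermite_poly k t = poly (herm k) t"
proof -
  have "hermite_poly k t = ((-1) * (-1)) ^ k * (exp (t\<^sup>2) * exp (- (t\<^sup>2))) * poly (herm k) t"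
    unfolding hermite_poly_def deriv_gauss_funpow power_mult_distrib by (simp only: mult_ac)
  then show ?thesis by (simp flip: exp_add)
qed

lemma pderiv_herm_Suc: "pderiv (herm (Suc k)) = smult (2 * real (Suc k)) (herm k)"
proof (induction k)
  case 0
  show ?case by (simp add: pderiv_pCons pderiv_diff pderiv_mult)
next
  case (Suc k)
  have "pderiv (herm (Suc (Suc k))) =
      smult 2 (herm (Suc k)) + [:0, 2:] * pderiv (herm (Suc k)) - pderiv (pderiv (herm (Suc k)))"
    by (subst herm.simps(2)) (simp add: pderiv_diff pderiv_mult pderiv_pCons pderiv_smult del: herm.simps)
  also have "\<dots> = smult 2 (herm (Suc k)) + smult (2 * real (Suc k)) ([:0, 2:] * herm k - pderiv (herm k))"
    unfolding Suc by (simp add: pderiv_smult smult_diff_right del: herm.simps)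
  also have "\<dots> = smult (2 * real (Suc (Suc k))) (herm (Suc k))"
    by (simp flip: herm.simps smult_add_left del: herm.simps) (simp add: algebra_simps flip: smult_add_left)
  finally show ?case .
qed

lemma poly_pderiv_herm: "poly (pderiv (herm k)) t = 2 * real k * poly (herm (k - 1)) t"
  by (cases k) (simp_all add: pderiv_herm_Suc del: herm.simps(2))

lemma poly_herm_Suc: "poly (herm (Suc k)) t = 2 * t * poly (herm k) t - 2 * real k * poly (herm (k - 1)) t"
  by (simp add: poly_pderiv_herm)

definition herm_const :: "nat \<Rightarrow> real" where
  "herm_const k = (2 ^ k * fact k * sqrt pi) powr (- 1 / 2)"

lemma herm_const_Suc: "herm_const (Suc k) * sqrt (2 * real (Suc k)) = herm_const k"
proof -
  have "herm_const (Suc k) = (2 * real (Suc k)) powr (- 1 / 2) * herm_const k"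
    unfolding herm_const_def by (subst powr_mult [symmetric]) (simp_all add: algebra_simps)
  moreover have "(2 * real (Suc k)) powr (- 1 / 2) * sqrt (2 * real (Suc k)) = 1"
    by (simp add: powr_half_sqrt [symmetric] powr_add [symmetric] del: of_nat_Suc)
  ultimately show ?thesis by (simp add: algebra_simps)
qed

lemma hermite_fun1_eq: "hermite_fun1 k t = herm_const k * poly (herm k) t * exp (- (t\<^sup>2) / 2)"
  by (simp add: hermite_fun1_def herm_const_def hermite_poly_eq_herm)

lemma herm_const_eqs:
  "sqrt (real (Suc k)) * herm_const (Suc k) = herm_const k / sqrt 2"
  "sqrt 2 * real k * herm_const k = sqrt (real k) * herm_const (k - 1)"
proof -
  show *: "sqrt (real (Suc k)) * herm_const (Suc k) = herm_const k / sqrt 2" for k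
    using herm_const_Suc[of k] by (simp add: real_sqrt_mult field_simps del: of_nat_Suc)
  show "sqrt 2 * real k * herm_const k = sqrt (real k) * herm_const (k - 1)"
  proof (cases k)
    case (Suc j)
    have "sqrt 2 * real k * herm_const k = sqrt 2 * sqrt (real k) * (sqrt (real k) * herm_const k)"
      by simp
    also have "\<dots> = sqrt (real k) * herm_const j"
      using *[of j] Suc by (simp del: of_nat_Suc)
    finally show ?thesis using Suc by simp
  qed simp
qed

text \<open>
  With \<open>a* h\<^sub>k = sqrt (k + 1) h\<^sub>k\<^sub>+\<^sub>1\<close> and \<open>a h\<^sub>k = sqrt k h\<^sub>k\<^sub>-\<^sub>1\<close> (raising and lowering), this and the next lemma
  are the identities \<open>sqrt 2 t = a* + a\<close> and \<open>sqrt 2 d/dt = a - a*\<close>. For \<open>k = 0\<close> the truncated index \<open>k - 1\<close> is harmless because its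
  coefficient vanishes.
\<close>

lemma hermite_fun1_recurrence:
  "sqrt 2 * t * hermite_fun1 k t =
     sqrt (real (Suc k)) * hermite_fun1 (Suc k) t + sqrt (real k) * hermite_fun1 (k - 1) t"
proof -
  let ?g = "exp (- (t\<^sup>2) / 2)"
  have "sqrt (real (Suc k)) * hermite_fun1 (Suc k) t + sqrt (real k) * hermite_fun1 (k - 1) t
      = (herm_const k / sqrt 2 * poly (herm (Suc k)) t + sqrt 2 * real k * herm_const k * poly (herm (k - 1)) t) * ?g"
    unfolding hermite_fun1_eq herm_const_eqs(1)[symmetric] herm_const_eqs(2) by (simp add: algebra_simps)
  also have "\<dots> = sqrt 2 * t * herm_const k * poly (herm k) t * ?g"
  proof -
    have "herm_const k / sqrt 2 * (2 * y) = (2 / sqrt 2) * herm_const k * y" for y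
      by simp
    then have "herm_const k / sqrt 2 * (2 * y) = sqrt 2 * herm_const k * y" for y
      by (simp add: real_div_sqrt zero_le_numeral)
    from this[of "t * poly (herm k) t - real k * poly (herm (k - 1)) t"] show ?thesis
      unfolding poly_herm_Suc by (simp add: algebra_simps)
  qed
  finally show ?thesis by (simp add: hermite_fun1_eq)
qed

lemma DERIV_hermite_fun1:
  "(hermite_fun1 k has_real_derivative
     (sqrt (real k) * hermite_fun1 (k - 1) t - sqrt (real (Suc k)) * hermite_fun1 (Suc k) t) / sqrt 2) (at t)"
proof -
  let ?g = "exp (- (t\<^sup>2) / 2)"
  have "hermite_fun1 k = (\<lambda>t. herm_const k * poly (herm k) t * exp (- (t\<^sup>2) / 2))"
    by (simp add: fun_eq_iff hermite_fun1_eq)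
  then have "(hermite_fun1 k has_real_derivative
      herm_const k * (2 * real k * poly (herm (k - 1)) t - t * poly (herm k) t) * ?g) (at t)"
    by (auto intro!: derivative_eq_intros poly_DERIV simp: algebra_simps poly_pderiv_herm)
  moreover have "herm_const k * (2 * real k * poly (herm (k - 1)) t - t * poly (herm k) t) * ?g =
    (2 * (sqrt (real k) * hermite_fun1 (k - 1) t) - sqrt 2 * t * hermite_fun1 k t) / sqrt 2"
    unfolding hermite_fun1_eq mult.assoc[symmetric] herm_const_eqs(2)[symmetric]
    by (simp add: diff_divide_distrib algebra_simps)
  ultimately show ?thesis
    unfolding hermite_fun1_recurrence by (simp only: algebra_simps) simp
qed

lemma continuous_on_hermite_fun1: "continuous_on A (hermite_fun1 k)"
  using DERIV_hermite_fun1 by (meson DERIV_continuous continuous_at_imp_continuous_on)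

lemma hermite_fun1_measurable [measurable]: "hermite_fun1 k \<in> borel_measurable borel"
  by (rule borel_measurable_continuous_onI[OF continuous_on_hermite_fun1])

subsection \<open>Orthonormality\<close>

lemma integrable_poly_gauss: "integrable lborel (\<lambda>t. poly p t * exp (- (t\<^sup>2)) :: real)"
proof -
  have "integrable lborel (\<lambda>t. t ^ k * exp (- (t\<^sup>2)) :: real)" for k
  proof -
    have "integrable lborel (\<lambda>t. sqrt pi * (normal_density 0 (1 / sqrt 2) t * (t - 0) ^ k))"
      by (intro integrable_mult_right integrable_normal_moment) simp
    also have "(\<lambda>t. sqrt pi * (normal_density 0 (1 / sqrt 2) t * (t - 0) ^ k)) = (\<lambda>t. t ^ k * exp (- (t\<^sup>2)))"
      by (simp add: normal_density_def fun_eq_iff power_divide)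
    finally show ?thesis .
  qed
  then have "integrable lborel (\<lambda>t. \<Sum>i\<le>degree p. coeff p i * (t ^ i * exp (- (t\<^sup>2))))"
    by (auto intro!: Bochner_Integration.integrable_sum)
  then show ?thesis
    by (simp add: poly_altdef sum_distrib_right mult.assoc)
qed

lemma tendsto_poly_gauss:
  "((\<lambda>t. poly p t * exp (- (t\<^sup>2)) :: real) \<longlongrightarrow> 0) at_top"
  "((\<lambda>t. poly p t * exp (- (t\<^sup>2)) :: real) \<longlongrightarrow> 0) at_bot"
proof -
  show *: "((\<lambda>t. poly p t * exp (- (t\<^sup>2)) :: real) \<longlongrightarrow> 0) at_top" for p
  proof -
    have "((\<lambda>t. t ^ k * exp (- (t\<^sup>2)) :: real) \<longlongrightarrow> 0) at_top" for k
    proof (rule Lim_null_comparison)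
      show "\<forall>\<^sub>F t in at_top. norm (t ^ k * exp (- (t\<^sup>2))) \<le> t ^ k / exp t"
        using eventually_ge_at_top[of "1::real"]
      proof eventually_elim
        case (elim t)
        then have "t \<le> t\<^sup>2" by (simp add: power2_eq_square)
        with elim have "t ^ k * exp (- (t\<^sup>2)) \<le> t ^ k * exp (- t)"
          by (intro mult_left_mono) auto
        with elim show ?case by (simp add: exp_minus field_simps)
      qed
    qed (rule tendsto_power_div_exp_0)
    then have "((\<lambda>t. \<Sum>i\<le>degree p. coeff p i * (t ^ i * exp (- (t\<^sup>2)))) \<longlongrightarrow> (\<Sum>i\<le>degree p. coeff p i * 0)) at_top"
      by (intro tendsto_sum tendsto_mult_left)
    then show ?thesis
      by (simp add: poly_altdef sum_distrib_right mult.assoc)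
  qed
  have "((\<lambda>t. poly (pcompose p [:0, -1:]) t * exp (- (t\<^sup>2)) :: real) \<longlongrightarrow> 0) at_top"
    by (rule *)
  then show "((\<lambda>t. poly p t * exp (- (t\<^sup>2)) :: real) \<longlongrightarrow> 0) at_bot"
    unfolding at_bot_mirror filterlim_filtermap by (simp add: poly_pcompose)
qed

lemma hermite_fun1_mult_eq_poly:
  "hermite_fun1 k t * hermite_fun1 l t = poly (smult (herm_const k * herm_const l) (herm k * herm l)) t * exp (- (t\<^sup>2))"
  by (simp add: hermite_fun1_eq mult_exp_exp flip: exp_add)

lemma integrable_hermite_fun1_mult: "integrable lborel (\<lambda>t. hermite_fun1 k t * hermite_fun1 l t)"
  unfolding hermite_fun1_mult_eq_poly by (rule integrable_poly_gauss)

lemma tendsto_hermite_fun1_mult: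
  "((\<lambda>t. hermite_fun1 k t * hermite_fun1 l t) \<longlongrightarrow> 0) at_top"
  "((\<lambda>t. hermite_fun1 k t * hermite_fun1 l t) \<longlongrightarrow> 0) at_bot"
  unfolding hermite_fun1_mult_eq_poly by (rule tendsto_poly_gauss)+

abbreviation herm_inner :: "nat \<Rightarrow> nat \<Rightarrow> real" where
  "herm_inner k l \<equiv> LINT t|lborel. hermite_fun1 k t * hermite_fun1 l t"

lemma DERIV_hermite_fun1_mult:
  "((\<lambda>t. hermite_fun1 k t * hermite_fun1 l t) has_real_derivative
     (sqrt 2 * sqrt (real l) * (hermite_fun1 k t * hermite_fun1 (l - 1) t)
      - sqrt 2 * sqrt (real (Suc k)) * (hermite_fun1 (Suc k) t * hermite_fun1 l t))) (at t)"
proof -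
  have "(sqrt (real k) * hermite_fun1 (k - 1) t - sqrt (real (Suc k)) * hermite_fun1 (Suc k) t) / sqrt 2
          = t * hermite_fun1 k t - sqrt 2 * sqrt (real (Suc k)) * hermite_fun1 (Suc k) t"
    using hermite_fun1_recurrence[of t k] by (simp add: field_simps)
  moreover have "(sqrt (real l) * hermite_fun1 (l - 1) t - sqrt (real (Suc l)) * hermite_fun1 (Suc l) t) / sqrt 2
          = sqrt 2 * sqrt (real l) * hermite_fun1 (l - 1) t - t * hermite_fun1 l t"
    using hermite_fun1_recurrence[of t l] by (simp add: field_simps)
  ultimately show ?thesis
    using DERIV_mult[OF DERIV_hermite_fun1[of k t] DERIV_hermite_fun1[of l t]]
    by (simp only: ) (simp add: algebra_simps)
qed

text \<open>
  Raising and lowering are adjoint to each other: \<open>(h\<^sub>k h\<^sub>l)' = sqrt 2 (h\<^sub>k a h\<^sub>l - a* h\<^sub>k h\<^sub>l)\<close>, because the terms with a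
  factor \<open>t\<close> cancel, and the integral of this derivative over the line is zero.
\<close>

lemma herm_inner_adjoint: "sqrt (real (Suc k)) * herm_inner (Suc k) l = sqrt (real l) * herm_inner k (l - 1)"
proof -
  define F where "F = (\<lambda>t. hermite_fun1 k t * hermite_fun1 l t)"
  define f where "f = (\<lambda>t. sqrt 2 * sqrt (real l) * (hermite_fun1 k t * hermite_fun1 (l - 1) t)
      - sqrt 2 * sqrt (real (Suc k)) * (hermite_fun1 (Suc k) t * hermite_fun1 l t))"
  have int: "integrable lborel f"
    unfolding f_def by (intro Bochner_Integration.integrable_diff integrable_mult_right integrable_hermite_fun1_mult)
  have "(LBINT t=-\<infinity>..\<infinity>. f t) = 0 - 0"
  proof (rule interval_integral_FTC_integrable)
    show "(F has_vector_derivative f t) (at t)" for t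
      unfolding F_def f_def has_real_derivative_iff_has_vector_derivative[symmetric]
      by (rule DERIV_hermite_fun1_mult)
    have "continuous_on UNIV f"
      unfolding f_def by (intro continuous_intros continuous_on_hermite_fun1)
    then show "isCont f t" for t
      by (simp add: continuous_on_eq_continuous_at)
    show "set_integrable lborel (einterval (-\<infinity>) \<infinity>) f"
      using int by (simp add: set_integrable_def)
    show "((F \<circ> real_of_ereal) \<longlongrightarrow> 0) (at_right (-\<infinity>))" "((F \<circ> real_of_ereal) \<longlongrightarrow> 0) (at_left \<infinity>)"
      using tendsto_hermite_fun1_mult by (simp_all add: ereal_tendsto_simps1 F_def)
  qed simp
  then have "(LINT t|lborel. f t) = 0"
    by (simp add: interval_integral_eq_integral' interval_lebesgue_integral_def set_lebesgue_integral_def)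
  then have "sqrt 2 * sqrt (real l) * herm_inner k (l - 1) - sqrt 2 * sqrt (real (Suc k)) * herm_inner (Suc k) l = 0"
    unfolding f_def
    by (subst (asm) Bochner_Integration.integral_diff)
       (auto intro!: integrable_mult_right integrable_hermite_fun1_mult)
  then show ?thesis by (simp add: algebra_simps)
qed

lemma herm_inner_00: "herm_inner 0 0 = 1"
proof -
  have "hermite_fun1 0 t * hermite_fun1 0 t = normal_density 0 (1 / sqrt 2) t" for t
  proof -
    have "herm_const 0 * herm_const 0 = 1 / sqrt pi"
      by (simp add: herm_const_def powr_add[symmetric] powr_minus field_simps)
    then show ?thesis
      unfolding hermite_fun1_mult_eq_poly by (simp add: normal_density_def power_divide)
  qed
  then show ?thesis by simp
qed

text \<open>
  Adjointness lowers both indices together until one of them is zero; a lowering operator then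
  annihilates \<open>h\<^sub>0\<close>, unless both are zero and the Gaussian integral remains.
\<close>

lemma hermite_fun1_orthonormal: "herm_inner k l = (if k = l then 1 else 0)"
proof (induction k arbitrary: l)
  case 0
  show ?case
  proof (cases l)
    case (Suc j)
    have "sqrt (real (Suc j)) * herm_inner (Suc j) 0 = 0"
      by (subst herm_inner_adjoint) simp
    moreover have "herm_inner 0 (Suc j) = herm_inner (Suc j) 0" by (simp add: mult.commute)
    ultimately show ?thesis using Suc by simp
  qed (simp add: herm_inner_00)
next
  case (Suc k)
  have *: "sqrt (real (Suc k)) * herm_inner (Suc k) l = sqrt (real l) * herm_inner k (l - 1)"
    by (rule herm_inner_adjoint)
  show ?case
  proof (cases l)
    case 0
    with * show ?thesis by simp
  next
    case (Suc j)
    with * Suc.IH[of j] show ?thesis by auto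
  qed
qed

subsection \<open>The size of the spectral function on the diagonal\<close>

text \<open>
  The derivative of the partial sum telescopes, in the manner of Christoffel and Darboux, to a multiple
  of the single product \<open>h\<^sub>R h\<^sub>R\<^sub>+\<^sub>1\<close>. The integral of its absolute value is at most one by orthonormality, so
  integrating in from infinity bounds the sum uniformly in \<open>t\<close> with the correct power of \<open>R\<close>.
\<close>

lemma sum_hermite_fun1_square_le: "(\<Sum>k\<le>R. (hermite_fun1 k t)\<^sup>2) \<le> sqrt (2 * real (Suc R))"
proof -
  define K where "K = (\<lambda>t. \<Sum>k\<le>R. (hermite_fun1 k t)\<^sup>2)"
  define w where "w = (\<lambda>t. hermite_fun1 R t * hermite_fun1 (Suc R) t)"
  have tel: "(\<Sum>k\<le>R. (sqrt (real k) * hermite_fun1 (k - 1) t - sqrt (real (Suc k)) * hermite_fun1 (Suc k) t) * hermite_fun1 k t)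
     = - sqrt (real (Suc R)) * w t" for t
  proof -
    have "(\<Sum>k\<le>R. (sqrt (real k) * hermite_fun1 (k - 1) t - sqrt (real (Suc k)) * hermite_fun1 (Suc k) t) * hermite_fun1 k t)
     = - sqrt (real (Suc R)) * (hermite_fun1 R t * hermite_fun1 (Suc R) t)" for R
      by (induction R) (simp_all add: algebra_simps del: of_nat_Suc)
    then show ?thesis by (simp add: w_def)
  qed
  have DK: "(K has_real_derivative - sqrt (2 * real (Suc R)) * w t) (at t)" for t
  proof -
    let ?d = "\<lambda>k. (sqrt (real k) * hermite_fun1 (k - 1) t - sqrt (real (Suc k)) * hermite_fun1 (Suc k) t)"
    have "((\<lambda>t. (hermite_fun1 k t)\<^sup>2) has_real_derivative 2 * hermite_fun1 k t * (?d k / sqrt 2)) (at t)" for k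
      using DERIV_power[OF DERIV_hermite_fun1[of k t], of 2] by (simp add: algebra_simps)
    then have "(K has_real_derivative (\<Sum>k\<le>R. 2 * hermite_fun1 k t * (?d k / sqrt 2))) (at t)"
      unfolding K_def by (intro DERIV_sum)
    moreover have "(\<Sum>k\<le>R. 2 * hermite_fun1 k t * (?d k / sqrt 2)) = sqrt 2 * (\<Sum>k\<le>R. ?d k * hermite_fun1 k t)"
    proof -
      have "2 * h * (d / sqrt 2) = (2 / sqrt 2) * (d * h)" for h d :: real by simp
      then have "2 * h * (d / sqrt 2) = sqrt 2 * (d * h)" for h d :: real by (simp only: real_div_sqrt zero_le_numeral)
      then show ?thesis unfolding sum_distrib_left by (intro sum.cong refl)
    qed
    ultimately have "(K has_real_derivative sqrt 2 * (- sqrt (real (Suc R)) * w t)) (at t)"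
      by (simp only: tel)
    then show ?thesis
      by (simp only: real_sqrt_mult mult_minus_left mult_minus_right mult.assoc)
  qed
  have contw: "continuous_on UNIV w"
    unfolding w_def by (intro continuous_intros continuous_on_hermite_fun1)
  have intw: "integrable lborel (\<lambda>t. \<bar>w t\<bar>)"
    unfolding w_def by (intro integrable_abs integrable_hermite_fun1_mult)
  have w1: "(LINT t|lborel. \<bar>w t\<bar>) \<le> 1"
  proof -
    have "(LINT t|lborel. \<bar>w t\<bar>) \<le>
        (LINT t|lborel. (hermite_fun1 R t * hermite_fun1 R t + hermite_fun1 (Suc R) t * hermite_fun1 (Suc R) t) / 2)"
    proof (rule integral_mono[OF intw])
      show "\<bar>w t\<bar> \<le> (hermite_fun1 R t * hermite_fun1 R t + hermite_fun1 (Suc R) t * hermite_fun1 (Suc R) t) / 2" for t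
        unfolding w_def
        using sum_squares_bound[of "\<bar>hermite_fun1 R t\<bar>" "\<bar>hermite_fun1 (Suc R) t\<bar>"]
        by (simp add: abs_mult power2_eq_square)
    qed (intro integrable_divide Bochner_Integration.integrable_add integrable_hermite_fun1_mult)
    also have "\<dots> = 1"
      by (simp add: hermite_fun1_orthonormal integrable_hermite_fun1_mult)
    finally show ?thesis .
  qed
  have diff: "K t - K b \<le> sqrt (2 * real (Suc R))" if "t \<le> b" for b
  proof -
    have "(LBINT s=t..b. - sqrt (2 * real (Suc R)) * w s) = K b - K t"
    proof (rule interval_integral_FTC_finite)
      show "continuous_on {min t b..max t b} (\<lambda>s. - sqrt (2 * real (Suc R)) * w s)"
        by (intro continuous_on_mult_left continuous_on_subset[OF contw] subset_UNIV)
      show "(K has_vector_derivative - sqrt (2 * real (Suc R)) * w s) (at s within {min t b..max t b})" for s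
        unfolding has_real_derivative_iff_has_vector_derivative[symmetric]
        by (rule has_field_derivative_at_within[OF DK])
    qed
    then have "K t - K b = sqrt (2 * real (Suc R)) * (LBINT s=t..b. w s)"
      by (subst (asm) interval_lebesgue_integral_mult_right) linarith
    also have "\<dots> \<le> sqrt (2 * real (Suc R)) * 1"
    proof (intro mult_left_mono)
      have "(LBINT s=t..b. w s) = (LINT s|lborel. indicator {t..b} s * w s)"
        using that by (simp add: interval_integral_Icc set_lebesgue_integral_def)
      also have "\<dots> \<le> (LINT s|lborel. \<bar>w s\<bar>)"
        using intw by (intro integral_mono_AE') (auto simp: indicator_def)
      finally show "(LBINT s=t..b. w s) \<le> 1" using w1 by simp
    qed simp
    finally show ?thesis by simp
  qed
  have "((\<lambda>b. K t - K b) \<longlongrightarrow> K t - 0) at_top"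
  proof -
    have "((\<lambda>b. \<Sum>k\<le>R. hermite_fun1 k b * hermite_fun1 k b) \<longlongrightarrow> (\<Sum>k\<le>R. 0)) at_top"
      by (intro tendsto_sum tendsto_hermite_fun1_mult)
    then show ?thesis
      unfolding K_def by (intro tendsto_diff tendsto_const) (simp add: power2_eq_square)
  qed
  moreover have "\<forall>\<^sub>F b in at_top. K t - K b \<le> sqrt (2 * real (Suc R))"
    using eventually_ge_at_top[of t] by eventually_elim (rule diff)
  ultimately show ?thesis
    by (auto simp: K_def dest: tendsto_upperbound)
qed

section \<open>Hermite functions in several variables\<close>

subsection \<open>Integrals of products of functions of one coordinate\<close>

lemma Basis_vec_eq: "(Basis :: (real ^ 'n) set) = range (\<lambda>i. axis i 1)"
  by (auto simp: Basis_vec_def)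

lemma inj_axis_1: "inj (\<lambda>i. axis i (1::real) :: real ^ 'n)"
  by (auto simp: inj_def axis_eq_axis)

lemma prod_Basis_vec:
  fixes x :: "real ^ ('n::finite)" and f :: "'n \<Rightarrow> real \<Rightarrow> 'b::comm_monoid_mult"
  shows "(\<Prod>b\<in>Basis. f (inv (\<lambda>i. axis i 1 :: real ^ 'n) b) (x \<bullet> b)) = (\<Prod>i\<in>UNIV. f i (x $ i))"
  unfolding Basis_vec_eq by (subst prod.reindex[OF inj_axis_1]) (simp add: inv_f_f[OF inj_axis_1] inner_axis)

lemma prod_Basis_const:
  fixes f :: "'n::finite \<Rightarrow> 'b::comm_monoid_mult"
  shows "(\<Prod>b\<in>(Basis :: (real ^ 'n) set). f (inv (\<lambda>i. axis i 1) b)) = (\<Prod>i\<in>UNIV. f i)"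
  unfolding Basis_vec_eq by (subst prod.reindex[OF inj_axis_1]) (simp add: inv_f_f[OF inj_axis_1])

lemma nn_integral_prod_coordinates:
  fixes f :: "'n::finite \<Rightarrow> real \<Rightarrow> ennreal"
  assumes "\<And>i. f i \<in> borel_measurable borel"
  shows "(\<integral>\<^sup>+x. (\<Prod>i\<in>UNIV. f i (x $ i)) \<partial>(lborel :: (real ^ 'n) measure)) = (\<Prod>i\<in>UNIV. \<integral>\<^sup>+t. f i t \<partial>lborel)"
  unfolding prod_Basis_vec[symmetric] prod_Basis_const[symmetric]
  by (rule nn_integral_lborel_prod) (use assms in auto)

lemma has_integral_prod_coordinates:
  fixes f :: "'n::finite \<Rightarrow> real \<Rightarrow> real"
  assumes int: "\<And>i. integrable lborel (f i)"
  shows "has_bochner_integral (lborel :: (real ^ 'n) measure)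
    (\<lambda>x. \<Prod>i\<in>UNIV. f i (x $ i)) (\<Prod>i\<in>UNIV. LINT t|lborel. f i t)"
proof -
  interpret product_sigma_finite "\<lambda>b :: real ^ 'n. lborel :: real measure" ..
  let ?g = "\<lambda>b. f (inv (\<lambda>i. axis i 1 :: real ^ 'n) b)"
  have [measurable]: "f i \<in> borel_measurable borel" for i
    using borel_measurable_integrable[OF int] by simp
  have coord: "(\<Prod>b\<in>Basis. ?g b ((\<Sum>b\<in>Basis. y b *\<^sub>R b) \<bullet> b)) = (\<Prod>b\<in>Basis. ?g b (y b))" for y
    by (intro prod.cong refl) simp
  have "has_bochner_integral (\<Pi>\<^sub>M b\<in>Basis. lborel) (\<lambda>y. \<Prod>b\<in>Basis. ?g b (y b)) (\<Prod>b\<in>Basis. LINT t|lborel. ?g b t)"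
    unfolding has_bochner_integral_iff
    using product_integral_prod[of Basis ?g] product_integrable_prod[of Basis ?g] int by simp
  then have "has_bochner_integral (distr (\<Pi>\<^sub>M b\<in>Basis. lborel) borel (\<lambda>y. \<Sum>b\<in>Basis. y b *\<^sub>R b))
      (\<lambda>x. \<Prod>b\<in>Basis. ?g b (x \<bullet> b)) (\<Prod>b\<in>Basis. LINT t|lborel. ?g b t)"
    by (intro has_bochner_integral_distr) (simp_all only: coord, measurable)
  then show ?thesis
    unfolding lborel_eq[symmetric] prod_Basis_vec prod_Basis_const[where f = "\<lambda>i. integral\<^sup>L lborel (f i)"] .
qed

subsection \<open>Multi-indices of bounded length\<close>

lemma nth_le_mi_abs: "\<xi> $ i \<le> mi_abs \<xi>"
  unfolding mi_abs_def by (rule member_le_sum) auto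

lemma mi_abs_add: "mi_abs (\<xi> + \<eta>) = mi_abs \<xi> + mi_abs \<eta>"
  by (simp add: mi_abs_def sum.distrib)

lemma mi_abs_axis: "mi_abs (axis i k) = k"
  unfolding mi_abs_def axis_def by simp

lemma mi_box_eq: "{\<xi> :: nat ^ 'n. \<forall>i. \<xi> $ i \<le> Q} = vec_lambda ` (UNIV \<rightarrow>\<^sub>E {..Q})"
proof -
  have "\<xi> \<in> vec_lambda ` (UNIV \<rightarrow>\<^sub>E {..Q})" if "\<forall>i. \<xi> $ i \<le> Q" for \<xi> :: "nat ^ 'n"
    using that by (intro image_eqI[of _ _ "vec_nth \<xi>"]) (auto simp: PiE_iff)
  then show ?thesis by (auto simp: PiE_iff)
qed

definition mi_ball :: "nat \<Rightarrow> (nat ^ 'n) set" where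
  "mi_ball Q = {\<xi>. mi_abs \<xi> \<le> Q}"

lemma mi_ball_subset_mi_box: "mi_ball Q \<subseteq> {\<xi>. \<forall>i. \<xi> $ i \<le> Q}"
  using nth_le_mi_abs le_trans by (fastforce simp: mi_ball_def)

lemma finite_mi_box: "finite {\<xi> :: nat ^ 'n. \<forall>i. \<xi> $ i \<le> Q}"
  unfolding mi_box_eq by (intro finite_imageI finite_PiE) auto

lemma finite_mi_ball: "finite (mi_ball Q)"
  using finite_subset[OF mi_ball_subset_mi_box finite_mi_box] .

subsection \<open>Ladder relation, orthonormality, diagonal bound\<close>

lemma hermite_fun_measurable [measurable]:
  "(hermite_fun \<xi> :: real ^ 'n \<Rightarrow> real) \<in> borel_measurable borel"
proof -
  have [measurable]: "(\<lambda>x :: real ^ 'n. x $ i) \<in> borel_measurable borel" for i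
    by (intro borel_measurable_continuous_onI continuous_intros)
  show ?thesis unfolding hermite_fun_def by measurable
qed

lemma hermite_fun_recurrence:
  "sqrt 2 * x $ i * hermite_fun \<xi> x =
     sqrt (real (Suc (\<xi> $ i))) * hermite_fun (\<xi> + axis i 1) x
   + sqrt (real (\<xi> $ i)) * hermite_fun (\<xi> - axis i 1) x"
proof -
  let ?P = "\<Prod>j\<in>UNIV - {i}. hermite_fun1 (\<xi> $ j) (x $ j)"
  have split: "hermite_fun \<eta> x = hermite_fun1 (\<eta> $ i) (x $ i) * ?P" if "\<And>j. j \<noteq> i \<Longrightarrow> \<eta> $ j = \<xi> $ j" for \<eta>
    unfolding hermite_fun_def using that by (subst prod.remove[of _ i]) auto
  have "hermite_fun \<xi> x = hermite_fun1 (\<xi> $ i) (x $ i) * ?P"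
       "hermite_fun (\<xi> + axis i 1) x = hermite_fun1 (Suc (\<xi> $ i)) (x $ i) * ?P"
       "hermite_fun (\<xi> - axis i 1) x = hermite_fun1 (\<xi> $ i - 1) (x $ i) * ?P"
    by (subst split; simp add: axis_def)+
  moreover have "sqrt 2 * x $ i * (hermite_fun1 (\<xi> $ i) (x $ i) * ?P) =
      sqrt (real (Suc (\<xi> $ i))) * (hermite_fun1 (Suc (\<xi> $ i)) (x $ i) * ?P)
      + sqrt (real (\<xi> $ i)) * (hermite_fun1 (\<xi> $ i - 1) (x $ i) * ?P)"
    unfolding mult.assoc[symmetric] hermite_fun1_recurrence by (simp add: distrib_right)
  ultimately show ?thesis
    by simp
qed

lemma hermite_fun_orthonormal:
  "has_bochner_integral lborel (\<lambda>x :: real ^ 'n. hermite_fun \<xi> x * hermite_fun \<eta> x) (if \<xi> = \<eta> then 1 else 0)"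
proof -
  have "has_bochner_integral (lborel :: (real ^ 'n) measure)
    (\<lambda>x. \<Prod>i\<in>UNIV. hermite_fun1 (\<xi> $ i) (x $ i) * hermite_fun1 (\<eta> $ i) (x $ i)) (\<Prod>i\<in>UNIV. herm_inner (\<xi> $ i) (\<eta> $ i))"
    by (rule has_integral_prod_coordinates) (rule integrable_hermite_fun1_mult)
  also have "(\<Prod>i\<in>UNIV. herm_inner (\<xi> $ i) (\<eta> $ i)) = (if \<xi> = \<eta> then 1 else 0)"
    by (auto simp: hermite_fun1_orthonormal vec_eq_iff)
  finally show ?thesis
    by (simp add: hermite_fun_def prod.distrib)
qed

lemma hermite_sum_square_integral:
  fixes c :: "nat ^ 'n \<Rightarrow> real"
  assumes "finite A"
  shows "has_bochner_integral lborel (\<lambda>x :: real ^ 'n. (\<Sum>\<xi>\<in>A. c \<xi> * hermite_fun \<xi> x)\<^sup>2) (\<Sum>\<xi>\<in>A. (c \<xi>)\<^sup>2)"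
proof -
  have "has_bochner_integral lborel
     (\<lambda>x :: real ^ 'n. \<Sum>\<xi>\<in>A. \<Sum>\<eta>\<in>A. c \<xi> * c \<eta> * (hermite_fun \<xi> x * hermite_fun \<eta> x))
     (\<Sum>\<xi>\<in>A. \<Sum>\<eta>\<in>A. c \<xi> * c \<eta> * (if \<xi> = \<eta> then 1 else 0))"
    by (intro has_bochner_integral_sum has_bochner_integral_mult_right hermite_fun_orthonormal)
  also have "(\<Sum>\<xi>\<in>A. \<Sum>\<eta>\<in>A. c \<xi> * c \<eta> * (if \<xi> = \<eta> then 1 else 0)) = (\<Sum>\<xi>\<in>A. (c \<xi>)\<^sup>2)"
    using assms by (simp add: if_distrib power2_eq_square cong: if_cong)
  finally show ?thesis
    by (simp add: power2_eq_square sum_product mult_ac)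
qed

lemma hermite_parseval:
  fixes c :: "nat ^ 'n \<Rightarrow> complex"
  assumes "finite A"
  shows "(\<integral>\<^sup>+x. ennreal ((cmod (\<Sum>\<xi>\<in>A. c \<xi> * complex_of_real (hermite_fun \<xi> x)))\<^sup>2) \<partial>(lborel :: (real ^ 'n) measure))
    = ennreal (\<Sum>\<xi>\<in>A. (cmod (c \<xi>))\<^sup>2)"
proof -
  have "has_bochner_integral lborel (\<lambda>x :: real ^ 'n. (\<Sum>\<xi>\<in>A. Re (c \<xi>) * hermite_fun \<xi> x)\<^sup>2 + (\<Sum>\<xi>\<in>A. Im (c \<xi>) * hermite_fun \<xi> x)\<^sup>2)
      ((\<Sum>\<xi>\<in>A. (Re (c \<xi>))\<^sup>2) + (\<Sum>\<xi>\<in>A. (Im (c \<xi>))\<^sup>2))"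
    using assms by (intro has_bochner_integral_add hermite_sum_square_integral)
  then have "has_bochner_integral lborel (\<lambda>x :: real ^ 'n. (cmod (\<Sum>\<xi>\<in>A. c \<xi> * complex_of_real (hermite_fun \<xi> x)))\<^sup>2)
      (\<Sum>\<xi>\<in>A. (cmod (c \<xi>))\<^sup>2)"
    by (simp add: cmod_power2 sum.distrib)
  then show ?thesis
    by (subst nn_integral_eq_integral) (auto simp: has_bochner_integral_iff)
qed

text \<open>
  The kernel of the spectral projection onto \<open>|\<xi>| \<le> Q\<close>, evaluated on the diagonal.
\<close>

definition spectral_diag :: "nat \<Rightarrow> real ^ 'n \<Rightarrow> real" where
  "spectral_diag Q x = (\<Sum>\<xi>\<in>mi_ball Q. (hermite_fun \<xi> x)\<^sup>2)"

lemma spectral_diag_nonneg: "spectral_diag Q x \<ge> 0"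
  by (simp add: spectral_diag_def sum_nonneg)

text \<open>
  The multi-indices of length at most \<open>Q\<close> lie in a box, over which the sum factorizes into
  one-dimensional sums.
\<close>

lemma spectral_diag_le: "spectral_diag Q (x :: real ^ 'n) \<le> sqrt (2 * real (Suc Q)) ^ CARD('n)"
proof -
  have "spectral_diag Q x \<le> (\<Sum>\<xi>\<in>{\<xi> :: nat ^ 'n. \<forall>i. \<xi> $ i \<le> Q}. (hermite_fun \<xi> x)\<^sup>2)"
    unfolding spectral_diag_def by (intro sum_mono2 finite_mi_box mi_ball_subset_mi_box) simp
  also have "\<dots> = (\<Sum>f\<in>UNIV \<rightarrow>\<^sub>E {..Q}. \<Prod>j\<in>UNIV. (hermite_fun1 (f j) (x $ j))\<^sup>2)"
    unfolding mi_box_eq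
    by (subst sum.reindex) (auto simp: inj_on_def vec_lambda_inject hermite_fun_def prod_power_distrib)
  also have "\<dots> = (\<Prod>j\<in>UNIV. \<Sum>k\<le>Q. (hermite_fun1 k (x $ j))\<^sup>2)"
    by (subst prod_sum_PiE) auto
  also have "\<dots> \<le> (\<Prod>j\<in>(UNIV::'n set). sqrt (2 * real (Suc Q)))"
    by (intro prod_mono) (auto simp: sum_nonneg sum_hermite_fun1_square_le simp del: of_nat_Suc)
  finally show ?thesis by simp
qed

section \<open>Multiplication by a coordinate difference\<close>

text \<open>
  The operator \<open>(a\<^sub>x* - a\<^sub>y*)\<^sup>p\<close>, made of the raising operators in the \<open>i\<close>-th coordinates of \<open>x\<close> and \<open>y\<close>,
  applied to \<open>h\<^sub>\<xi>(x) h\<^sub>\<eta>(y)\<close>. The two indices are kept independent so that the recursion closes.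
\<close>

fun ladder_pow :: "'n \<Rightarrow> real ^ 'n \<Rightarrow> real ^ 'n \<Rightarrow> nat \<Rightarrow> nat ^ 'n \<Rightarrow> nat ^ 'n \<Rightarrow> real" where
  "ladder_pow i x y 0 \<xi> \<eta> = hermite_fun \<xi> x * hermite_fun \<eta> y"
| "ladder_pow i x y (Suc p) \<xi> \<eta> =
     sqrt (real (Suc (\<xi> $ i))) * ladder_pow i x y p (\<xi> + axis i 1) \<eta>
   - sqrt (real (Suc (\<eta> $ i))) * ladder_pow i x y p \<xi> (\<eta> + axis i 1)"

lemma sqrt_nth_diff_axis:
  "sqrt (real (\<xi> $ i)) * (sqrt (real (Suc ((\<xi> - axis i 1) $ i))) * f (\<xi> - axis i 1 + axis i 1)) = real (\<xi> $ i) * f \<xi>"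
proof (cases "\<xi> $ i = 0")
  case False
  then have "\<xi> - axis i 1 + axis i 1 = \<xi>" "Suc ((\<xi> - axis i 1) $ i) = \<xi> $ i"
    by (auto simp: vec_eq_iff axis_def)
  then show ?thesis by (simp only:) simp
qed simp

lemma ladder_pow_lower:
  "sqrt (real (\<xi> $ i)) * ladder_pow i x y (Suc p) (\<xi> - axis i 1) \<eta>
     = real (\<xi> $ i) * ladder_pow i x y p \<xi> \<eta>
     - sqrt (real (\<xi> $ i)) * sqrt (real (Suc (\<eta> $ i))) * ladder_pow i x y p (\<xi> - axis i 1) (\<eta> + axis i 1)"
  "sqrt (real (\<eta> $ i)) * ladder_pow i x y (Suc p) \<xi> (\<eta> - axis i 1)
     = sqrt (real (\<eta> $ i)) * sqrt (real (Suc (\<xi> $ i))) * ladder_pow i x y p (\<xi> + axis i 1) (\<eta> - axis i 1)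
     - real (\<eta> $ i) * ladder_pow i x y p \<xi> \<eta>"
  using sqrt_nth_diff_axis[of \<xi> i "\<lambda>\<xi>. ladder_pow i x y p \<xi> \<eta>"]
    sqrt_nth_diff_axis[of \<eta> i "\<lambda>\<eta>. ladder_pow i x y p \<xi> \<eta>"]
  by (simp_all only: ladder_pow.simps right_diff_distrib mult.assoc)

text \<open>
  By the ladder relation \<open>sqrt 2 (x\<^sub>i - y\<^sub>i) = (a\<^sub>x* - a\<^sub>y*) + (a\<^sub>x - a\<^sub>y)\<close>. The commutator of \<open>a\<^sub>x - a\<^sub>y\<close> with
  \<open>a\<^sub>x* - a\<^sub>y*\<close> is the scalar 2, so moving the lowering part past \<open>p\<close> raising factors, down to the indices,
  leaves \<open>2 p\<close> times the power \<open>p - 1\<close>.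
\<close>

lemma mult_ladder_pow:
  "sqrt 2 * (x $ i - y $ i) * ladder_pow i x y p \<xi> \<eta> =
     ladder_pow i x y (Suc p) \<xi> \<eta>
   + sqrt (real (\<xi> $ i)) * ladder_pow i x y p (\<xi> - axis i 1) \<eta>
   - sqrt (real (\<eta> $ i)) * ladder_pow i x y p \<xi> (\<eta> - axis i 1)
   + 2 * real p * ladder_pow i x y (p - 1) \<xi> \<eta>"
proof (induction p arbitrary: \<xi> \<eta>)
  case 0
  have "sqrt 2 * (x $ i - y $ i) * ladder_pow i x y 0 \<xi> \<eta> =
      (sqrt 2 * x $ i * hermite_fun \<xi> x) * hermite_fun \<eta> y - hermite_fun \<xi> x * (sqrt 2 * y $ i * hermite_fun \<eta> y)"
    by (simp add: algebra_simps)
  then show ?case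
    unfolding hermite_fun_recurrence by (simp add: algebra_simps del: of_nat_Suc)
next
  case (Suc p)
  define L where "L = ladder_pow i x y"
  define e where "e = (axis i 1 :: nat ^ 'a)"
  define a b where "a = sqrt (real (Suc (\<xi> $ i)))" and "b = sqrt (real (Suc (\<eta> $ i)))"
  have aa: "a * (a * z) = (real (\<xi> $ i) + 1) * z" and bb: "b * (b * z) = (real (\<eta> $ i) + 1) * z" for z
    by (simp_all add: a_def b_def flip: mult.assoc)
  have Suc': "L (Suc q) \<xi> \<eta> = a * L q (\<xi> + e) \<eta> - b * L q \<xi> (\<eta> + e)" for q
    by (simp add: L_def a_def b_def e_def)
  have p: "2 * real p * (a * L (p - 1) (\<xi> + e) \<eta> - b * L (p - 1) \<xi> (\<eta> + e)) = 2 * real p * L p \<xi> \<eta>"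
    by (cases p) (simp_all add: Suc')
  have IH1: "sqrt 2 * (x $ i - y $ i) * L p (\<xi> + e) \<eta> =
     L (Suc p) (\<xi> + e) \<eta> + a * L p \<xi> \<eta>
     - sqrt (real (\<eta> $ i)) * L p (\<xi> + e) (\<eta> - e) + 2 * real p * L (p - 1) (\<xi> + e) \<eta>"
    using Suc[of "\<xi> + e" \<eta>] unfolding L_def e_def a_def by simp
  have IH2: "sqrt 2 * (x $ i - y $ i) * L p \<xi> (\<eta> + e) =
     L (Suc p) \<xi> (\<eta> + e) + sqrt (real (\<xi> $ i)) * L p (\<xi> - e) (\<eta> + e)
     - b * L p \<xi> \<eta> + 2 * real p * L (p - 1) \<xi> (\<eta> + e)"
    using Suc[of \<xi> "\<eta> + e"] unfolding L_def e_def b_def by simp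
  have "sqrt 2 * (x $ i - y $ i) * L (Suc p) \<xi> \<eta> =
     a * (sqrt 2 * (x $ i - y $ i) * L p (\<xi> + e) \<eta>) - b * (sqrt 2 * (x $ i - y $ i) * L p \<xi> (\<eta> + e))"
    unfolding Suc' by (simp only: algebra_simps)
  \<comment> \<open>The two terms with \<open>a * a\<close> and \<open>b * b\<close> produce the commutator contribution \<open>2 L p\<close>.\<close>
  also have "\<dots> = (a * L (Suc p) (\<xi> + e) \<eta> - b * L (Suc p) \<xi> (\<eta> + e))
     + (a * (a * L p \<xi> \<eta>) + b * (b * L p \<xi> \<eta>))
     - sqrt (real (\<eta> $ i)) * a * L p (\<xi> + e) (\<eta> - e) - sqrt (real (\<xi> $ i)) * b * L p (\<xi> - e) (\<eta> + e)
     + 2 * real p * (a * L (p - 1) (\<xi> + e) \<eta> - b * L (p - 1) \<xi> (\<eta> + e))"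
    unfolding IH1 IH2 by (simp only: algebra_simps)
  also have "\<dots> = L (Suc (Suc p)) \<xi> \<eta>
      + (real (\<xi> $ i) * L p \<xi> \<eta> - sqrt (real (\<xi> $ i)) * b * L p (\<xi> - e) (\<eta> + e))
      - (sqrt (real (\<eta> $ i)) * a * L p (\<xi> + e) (\<eta> - e) - real (\<eta> $ i) * L p \<xi> \<eta>)
      + 2 * (real p + 1) * L p \<xi> \<eta>"
    unfolding aa bb p Suc'[of "Suc p"] by (simp add: algebra_simps)
  also have "real (\<xi> $ i) * L p \<xi> \<eta> - sqrt (real (\<xi> $ i)) * b * L p (\<xi> - e) (\<eta> + e)
      = sqrt (real (\<xi> $ i)) * L (Suc p) (\<xi> - e) \<eta>"
    unfolding L_def b_def e_def by (rule ladder_pow_lower(1)[symmetric])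
  also have "sqrt (real (\<eta> $ i)) * a * L p (\<xi> + e) (\<eta> - e) - real (\<eta> $ i) * L p \<xi> \<eta>
      = sqrt (real (\<eta> $ i)) * L (Suc p) \<xi> (\<eta> - e)"
    unfolding L_def a_def e_def by (rule ladder_pow_lower(2)[symmetric])
  finally show ?case
    unfolding L_def e_def by (simp add: add.commute del: ladder_pow.simps)
qed

lemma sum_mi_ball_shift:
  fixes g :: "nat ^ 'n \<Rightarrow> 'b::comm_monoid_add"
  assumes "\<And>\<xi>. \<xi> $ i = 0 \<Longrightarrow> g \<xi> = 0" and "\<And>\<xi>. \<xi> \<notin> mi_ball Q \<Longrightarrow> g \<xi> = 0"
  shows "(\<Sum>\<xi>\<in>mi_ball Q. g \<xi>) = (\<Sum>\<xi>\<in>mi_ball Q. g (\<xi> + axis i 1))"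
proof -
  let ?e = "axis i 1 :: nat ^ 'n"
  have "(\<Sum>\<xi>\<in>mi_ball Q. g (\<xi> + ?e)) = (\<Sum>\<xi>\<in>(\<lambda>\<xi>. \<xi> + ?e) ` mi_ball Q. g \<xi>)"
    by (subst sum.reindex) auto
  also have "\<dots> = (\<Sum>\<xi>\<in>(\<lambda>\<xi>. \<xi> + ?e) ` mi_ball Q \<union> mi_ball Q. g \<xi>)"
  proof (rule sum.mono_neutral_left)
    show "\<forall>\<xi>\<in>(\<lambda>\<xi>. \<xi> + ?e) ` mi_ball Q \<union> mi_ball Q - (\<lambda>\<xi>. \<xi> + ?e) ` mi_ball Q. g \<xi> = 0"
    proof
      fix \<xi> assume \<xi>: "\<xi> \<in> (\<lambda>\<xi>. \<xi> + ?e) ` mi_ball Q \<union> mi_ball Q - (\<lambda>\<xi>. \<xi> + ?e) ` mi_ball Q"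
      have "\<xi> $ i = 0"
      proof (rule ccontr)
        assume "\<xi> $ i \<noteq> 0"
        then have eq: "\<xi> = \<xi> - ?e + ?e" by (auto simp: vec_eq_iff axis_def)
        have "mi_abs \<xi> = mi_abs (\<xi> - ?e) + mi_abs ?e"
          by (subst eq) (rule mi_abs_add)
        with \<xi> have "\<xi> - ?e \<in> mi_ball Q" by (auto simp: mi_ball_def)
        with \<xi> eq show False by blast
      qed
      then show "g \<xi> = 0" by (rule assms)
    qed
  qed (auto simp: finite_mi_ball)
  also have "\<dots> = (\<Sum>\<xi>\<in>mi_ball Q. g \<xi>)"
    by (rule sum.mono_neutral_right) (auto simp: finite_mi_ball assms)
  finally show ?thesis ..
qed

definition ladder_kernel :: "nat \<Rightarrow> 'n \<Rightarrow> nat \<Rightarrow> (nat ^ 'n \<Rightarrow> complex) \<Rightarrow> real ^ 'n \<Rightarrow> real ^ 'n \<Rightarrow> complex" where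
  "ladder_kernel Q i p a x y = (\<Sum>\<xi>\<in>mi_ball Q. a \<xi> * complex_of_real (ladder_pow i x y p \<xi> \<xi>))"

text \<open>
  On the diagonal, the lowering part of \<open>mult_ladder_pow\<close> at \<open>\<xi>\<close> is, up to sign, the raising part at
  \<open>\<xi> - e\<^sub>i\<close>. Summation by parts therefore combines both into a single raising factor that acts with the
  coefficients \<open>-\<triangle>\<^sub>i a\<close>: multiplication by \<open>x\<^sub>i - y\<^sub>i\<close> differentiates the symbol.
\<close>

lemma mult_ladder_kernel:
  assumes supp: "\<And>\<xi>. \<xi> \<notin> mi_ball Q \<Longrightarrow> a \<xi> = 0"
  shows "complex_of_real (sqrt 2 * (x $ i - y $ i)) * ladder_kernel Q i p a x y =
     2 * of_nat p * ladder_kernel Q i (p - 1) a x y - ladder_kernel Q i (Suc p) (fdiff i a) x y"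
proof -
  define L where "L = ladder_pow i x y"
  define e where "e = (axis i 1 :: nat ^ 'a)"
  define g where "g \<xi> = sqrt (real (\<xi> $ i)) * (L p \<xi> (\<xi> - e) - L p (\<xi> - e) \<xi>)" for \<xi>
  have g: "g (\<xi> + e) = L (Suc p) \<xi> \<xi>" for \<xi>
    by (simp add: g_def L_def e_def algebra_simps)
  have one: "complex_of_real (sqrt 2 * (x $ i - y $ i)) * (a \<xi> * complex_of_real (L p \<xi> \<xi>)) =
      a \<xi> * complex_of_real (L (Suc p) \<xi> \<xi>) - a \<xi> * complex_of_real (g \<xi>)
      + 2 * of_nat p * (a \<xi> * complex_of_real (L (p - 1) \<xi> \<xi>))" for \<xi>
  proof -
    have "complex_of_real (sqrt 2 * (x $ i - y $ i)) * (a \<xi> * complex_of_real (L p \<xi> \<xi>)) =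
        a \<xi> * complex_of_real (sqrt 2 * (x $ i - y $ i) * L p \<xi> \<xi>)"
      by simp
    also have "sqrt 2 * (x $ i - y $ i) * L p \<xi> \<xi> = L (Suc p) \<xi> \<xi> - g \<xi> + 2 * real p * L (p - 1) \<xi> \<xi>"
      unfolding L_def g_def e_def mult_ladder_pow by (simp only: algebra_simps)
    also have "a \<xi> * complex_of_real \<dots> = a \<xi> * complex_of_real (L (Suc p) \<xi> \<xi>) - a \<xi> * complex_of_real (g \<xi>)
      + 2 * of_nat p * (a \<xi> * complex_of_real (L (p - 1) \<xi> \<xi>))"
      by (simp add: algebra_simps)
    finally show ?thesis .
  qed
  have "(\<Sum>\<xi>\<in>mi_ball Q. a \<xi> * complex_of_real (g \<xi>)) = (\<Sum>\<xi>\<in>mi_ball Q. a (\<xi> + e) * complex_of_real (g (\<xi> + e)))"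
    unfolding e_def by (rule sum_mi_ball_shift[where i = i]) (auto simp: g_def supp)
  then have shift: "(\<Sum>\<xi>\<in>mi_ball Q. a \<xi> * complex_of_real (g \<xi>)) = (\<Sum>\<xi>\<in>mi_ball Q. a (\<xi> + e) * complex_of_real (L (Suc p) \<xi> \<xi>))"
    unfolding g .
  have "complex_of_real (sqrt 2 * (x $ i - y $ i)) * ladder_kernel Q i p a x y =
     (\<Sum>\<xi>\<in>mi_ball Q. a \<xi> * complex_of_real (L (Suc p) \<xi> \<xi>)) - (\<Sum>\<xi>\<in>mi_ball Q. a \<xi> * complex_of_real (g \<xi>))
      + 2 * of_nat p * ladder_kernel Q i (p - 1) a x y"
    unfolding ladder_kernel_def sum_distrib_left L_def[symmetric] one
    by (simp only: sum.distrib sum_subtractf)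
  then show ?thesis
    unfolding shift by (simp add: ladder_kernel_def fdiff_def L_def e_def left_diff_distrib sum_subtractf)
qed

section \<open>Weighted square integrals of the kernel\<close>

lemma nn_integral_cmod_square_diff:
  assumes [measurable]: "F \<in> borel_measurable M" "G \<in> borel_measurable M"
  shows "(\<integral>\<^sup>+y. ennreal ((cmod (F y - G y))\<^sup>2) \<partial>M)
     \<le> 2 * (\<integral>\<^sup>+y. ennreal ((cmod (F y))\<^sup>2) \<partial>M) + 2 * (\<integral>\<^sup>+y. ennreal ((cmod (G y))\<^sup>2) \<partial>M)"
proof -
  have "ennreal ((cmod (F y - G y))\<^sup>2) \<le> 2 * ennreal ((cmod (F y))\<^sup>2) + 2 * ennreal ((cmod (G y))\<^sup>2)" for y
  proof -
    have "(cmod (F y - G y))\<^sup>2 \<le> (cmod (F y) + cmod (G y))\<^sup>2"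
      by (intro power_mono norm_triangle_ineq4) simp
    also have "\<dots> \<le> 2 * (cmod (F y))\<^sup>2 + 2 * (cmod (G y))\<^sup>2"
      using sum_squares_bound[of "cmod (F y)" "cmod (G y)"] by (simp add: power2_sum)
    finally have "ennreal ((cmod (F y - G y))\<^sup>2) \<le> ennreal (2 * (cmod (F y))\<^sup>2 + 2 * (cmod (G y))\<^sup>2)"
      by (rule ennreal_leI)
    then show ?thesis by (simp add: ennreal_mult'')
  qed
  then have "(\<integral>\<^sup>+y. ennreal ((cmod (F y - G y))\<^sup>2) \<partial>M)
     \<le> (\<integral>\<^sup>+y. 2 * ennreal ((cmod (F y))\<^sup>2) + 2 * ennreal ((cmod (G y))\<^sup>2) \<partial>M)"
    by (rule nn_integral_mono)
  also have "\<dots> = 2 * (\<integral>\<^sup>+y. ennreal ((cmod (F y))\<^sup>2) \<partial>M) + 2 * (\<integral>\<^sup>+y. ennreal ((cmod (G y))\<^sup>2) \<partial>M)"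
    by (simp add: nn_integral_add nn_integral_cmult)
  finally show ?thesis .
qed

lemma ladder_pow_measurable [measurable]: "(\<lambda>y. ladder_pow i x y p \<xi> \<eta>) \<in> borel_measurable borel"
  by (induction p arbitrary: \<xi> \<eta>) auto

text \<open>
  Every ladder factor is a difference of two terms with coefficients at most \<open>sqrt Q\<close>; squaring it costs
  a factor \<open>4 Q\<close>. Once all factors are expanded, Parseval's identity in \<open>y\<close> leaves the diagonal spectral
  function at \<open>x\<close>. The offsets \<open>\<alpha>\<close>, \<open>\<beta>\<close> record the expansion in the induction.
\<close>

lemma ladder_pow_L2:
  fixes c :: "nat ^ 'n \<Rightarrow> complex"
  assumes "finite A" and "\<And>\<xi>. \<xi> \<in> A \<Longrightarrow> cmod (c \<xi>) \<le> M"
    and "\<And>\<xi>. \<xi> \<in> A \<Longrightarrow> mi_abs (\<xi> + \<alpha>) + p \<le> Q" "\<And>\<xi>. \<xi> \<in> A \<Longrightarrow> mi_abs (\<xi> + \<beta>) + p \<le> Q"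
  shows "(\<integral>\<^sup>+y. ennreal ((cmod (\<Sum>\<xi>\<in>A. c \<xi> * complex_of_real (ladder_pow i x y p (\<xi> + \<alpha>) (\<xi> + \<beta>))))\<^sup>2) \<partial>lborel)
    \<le> ennreal (4 ^ p * real Q ^ p * M\<^sup>2 * spectral_diag Q x)"
  using assms(2-)
proof (induction p arbitrary: c M \<alpha> \<beta>)
  case 0
  have inj: "inj_on (\<lambda>\<xi>. \<xi> + \<gamma>) A" for \<gamma> by (auto simp: inj_on_def)
  have "(\<integral>\<^sup>+y. ennreal ((cmod (\<Sum>\<xi>\<in>A. c \<xi> * complex_of_real (ladder_pow i x y 0 (\<xi> + \<alpha>) (\<xi> + \<beta>))))\<^sup>2) \<partial>lborel)
    = (\<integral>\<^sup>+y. ennreal ((cmod (\<Sum>\<eta>\<in>(\<lambda>\<xi>. \<xi> + \<beta>) ` A. (c (\<eta> - \<beta>) * complex_of_real (hermite_fun (\<eta> - \<beta> + \<alpha>) x)) * complex_of_real (hermite_fun \<eta> y)))\<^sup>2) \<partial>lborel)"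
    by (subst sum.reindex[OF inj]) (simp add: mult.assoc)
  also have "\<dots> = ennreal (\<Sum>\<xi>\<in>A. (cmod (c \<xi> * complex_of_real (hermite_fun (\<xi> + \<alpha>) x)))\<^sup>2)"
    by (subst hermite_parseval) (simp_all add: assms(1) sum.reindex[OF inj])
  also have "\<dots> \<le> ennreal (4 ^ 0 * real Q ^ 0 * M\<^sup>2 * spectral_diag Q x)"
  proof (rule ennreal_leI)
    have "(\<Sum>\<xi>\<in>A. (cmod (c \<xi> * complex_of_real (hermite_fun (\<xi> + \<alpha>) x)))\<^sup>2)
        \<le> (\<Sum>\<xi>\<in>A. M\<^sup>2 * (hermite_fun (\<xi> + \<alpha>) x)\<^sup>2)"
      using 0(1) by (intro sum_mono) (auto simp: norm_mult power_mult_distrib intro!: mult_right_mono power_mono)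
    also have "\<dots> = M\<^sup>2 * (\<Sum>\<xi>\<in>(\<lambda>\<xi>. \<xi> + \<alpha>) ` A. (hermite_fun \<xi> x)\<^sup>2)"
      by (simp add: sum.reindex[OF inj] sum_distrib_left)
    also have "\<dots> \<le> M\<^sup>2 * spectral_diag Q x"
      unfolding spectral_diag_def using 0(2)
      by (intro mult_left_mono sum_mono2 finite_mi_ball) (auto simp: mi_ball_def)
    finally show "(\<Sum>\<xi>\<in>A. (cmod (c \<xi> * complex_of_real (hermite_fun (\<xi> + \<alpha>) x)))\<^sup>2)
        \<le> 4 ^ 0 * real Q ^ 0 * M\<^sup>2 * spectral_diag Q x" by simp
  qed
  finally show ?case .
next
  case (Suc p)
  let ?e = "axis i 1 :: nat ^ 'n"
  let ?L = "\<lambda>y \<xi> \<eta>. complex_of_real (ladder_pow i x y p \<xi> \<eta>)"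
  let ?B = "ennreal (4 ^ p * real Q ^ p * (M * sqrt (real Q))\<^sup>2 * spectral_diag Q x)"
  define c1 where "c1 \<xi> = c \<xi> * complex_of_real (sqrt (real (Suc ((\<xi> + \<alpha>) $ i))))" for \<xi>
  define c2 where "c2 \<xi> = c \<xi> * complex_of_real (sqrt (real (Suc ((\<xi> + \<beta>) $ i))))" for \<xi>
  have bd: "cmod (c \<xi> * complex_of_real (sqrt (real (Suc ((\<xi> + \<gamma>) $ i))))) \<le> M * sqrt (real Q)"
    if "\<xi> \<in> A" "mi_abs (\<xi> + \<gamma>) + Suc p \<le> Q" for \<xi> \<gamma>
  proof -
    have "Suc ((\<xi> + \<gamma>) $ i) \<le> Q" using nth_le_mi_abs[of "\<xi> + \<gamma>" i] that by linarith
    moreover have "0 \<le> M" using Suc(2)[OF that(1)] norm_ge_zero order_trans by blast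
    ultimately show ?thesis
      unfolding norm_mult using Suc(2)[OF that(1)] by (intro mult_mono) (auto simp del: of_nat_Suc)
  qed
  have abs_e: "mi_abs (\<xi> + (\<gamma> + ?e)) = Suc (mi_abs (\<xi> + \<gamma>))" for \<xi> \<gamma>
    by (simp add: mi_abs_add mi_abs_axis)
  have 1: "(\<integral>\<^sup>+y. ennreal ((cmod (\<Sum>\<xi>\<in>A. c1 \<xi> * ?L y (\<xi> + (\<alpha> + ?e)) (\<xi> + \<beta>)))\<^sup>2) \<partial>lborel) \<le> ?B"
    using bd[of _ \<alpha>] Suc(3,4) by (intro Suc.IH) (simp_all add: c1_def abs_e Suc_leD del: One_nat_def)
  have 2: "(\<integral>\<^sup>+y. ennreal ((cmod (\<Sum>\<xi>\<in>A. c2 \<xi> * ?L y (\<xi> + \<alpha>) (\<xi> + (\<beta> + ?e))))\<^sup>2) \<partial>lborel) \<le> ?B"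
    using bd[of _ \<beta>] Suc(3,4) by (intro Suc.IH) (simp_all add: c2_def abs_e Suc_leD del: One_nat_def)
  have "(\<Sum>\<xi>\<in>A. c \<xi> * complex_of_real (ladder_pow i x y (Suc p) (\<xi> + \<alpha>) (\<xi> + \<beta>)))
      = (\<Sum>\<xi>\<in>A. c1 \<xi> * ?L y (\<xi> + (\<alpha> + ?e)) (\<xi> + \<beta>)) - (\<Sum>\<xi>\<in>A. c2 \<xi> * ?L y (\<xi> + \<alpha>) (\<xi> + (\<beta> + ?e)))" for y
    unfolding sum_subtractf[symmetric] c1_def c2_def
    by (intro sum.cong refl) (simp add: algebra_simps del: of_nat_Suc)
  then have "(\<integral>\<^sup>+y. ennreal ((cmod (\<Sum>\<xi>\<in>A. c \<xi> * complex_of_real (ladder_pow i x y (Suc p) (\<xi> + \<alpha>) (\<xi> + \<beta>))))\<^sup>2) \<partial>lborel)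
    \<le> 2 * (\<integral>\<^sup>+y. ennreal ((cmod (\<Sum>\<xi>\<in>A. c1 \<xi> * ?L y (\<xi> + (\<alpha> + ?e)) (\<xi> + \<beta>)))\<^sup>2) \<partial>lborel)
    + 2 * (\<integral>\<^sup>+y. ennreal ((cmod (\<Sum>\<xi>\<in>A. c2 \<xi> * ?L y (\<xi> + \<alpha>) (\<xi> + (\<beta> + ?e))))\<^sup>2) \<partial>lborel)"
    by (simp only:) (rule nn_integral_cmod_square_diff; measurable)
  also have "\<dots> \<le> 2 * ?B + 2 * ?B"
    by (intro add_mono mult_left_mono 1 2) simp_all
  also have "\<dots> = ennreal (4 * (4 ^ p * real Q ^ p * (M * sqrt (real Q))\<^sup>2 * spectral_diag Q x))"
    unfolding ennreal_mult'[OF zero_le_numeral] by (simp flip: distrib_right)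
  also have "\<dots> = ennreal (4 ^ Suc p * real Q ^ Suc p * M\<^sup>2 * spectral_diag Q x)"
    by (simp add: power_mult_distrib mult_ac)
  finally show ?case .
qed

text \<open>
  The recursion is that of \<open>mult_ladder_kernel\<close> after \<open>|u - v|\<^sup>2 \<le> 2 |u|\<^sup>2 + 2 |v|\<^sup>2\<close>; at \<open>p = 0\<close> the second
  coefficient vanishes, so the truncated \<open>p - 1\<close> is harmless.
\<close>

fun moment_const :: "nat \<Rightarrow> nat \<Rightarrow> real" where
  "moment_const 0 p = 4 ^ p"
| "moment_const (Suc t) p = 2 * moment_const t (Suc p) + 8 * (real p)\<^sup>2 * moment_const t (p - 1)"

lemma moment_const_nonneg: "moment_const t p \<ge> 0"
  by (induction t arbitrary: p) auto

lemma ladder_kernel_measurable [measurable]: "ladder_kernel Q i p a x \<in> borel_measurable borel"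
  unfolding ladder_kernel_def by measurable

lemma vec_nth_measurable [measurable]: "(\<lambda>x :: real ^ 'n. x $ i) \<in> borel_measurable borel"
  by (intro borel_measurable_continuous_onI continuous_intros)

text \<open>
  Each factor \<open>sqrt 2 (x\<^sub>i - y\<^sub>i)\<close> gains \<open>sqrt Q\<close> in norm. Either it takes a difference of the symbol, worth \<open>Q\<close>,
  at the price of one additional raising factor of size \<open>sqrt Q\<close>, or it removes a raising factor. Hence
  \<open>t\<close> factors are compensated by \<open>Q\<^sup>t\<close> in the square.
\<close>

lemma ladder_kernel_weighted_L2:
  fixes a :: "nat ^ 'n \<Rightarrow> complex"
  assumes "Q > 0" and "\<And>\<xi>. a \<xi> \<noteq> 0 \<Longrightarrow> mi_abs \<xi> + t + p \<le> Q"
    and "\<And>l \<xi>. l \<le> t \<Longrightarrow> cmod ((fdiff i ^^ l) a \<xi>) * real Q ^ l \<le> M"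
  shows "ennreal (real Q ^ t) *
     (\<integral>\<^sup>+y. ennreal ((cmod (complex_of_real (sqrt 2 * (x $ i - y $ i)) ^ t * ladder_kernel Q i p a x y))\<^sup>2) \<partial>lborel)
    \<le> ennreal (moment_const t p * real Q ^ p * M\<^sup>2 * spectral_diag Q x)"
  using assms(2-)
proof (induction t arbitrary: p a M)
  case 0
  have eq: "ladder_kernel Q i p a x y = (\<Sum>\<xi>\<in>{\<xi>\<in>mi_ball Q. a \<xi> \<noteq> 0}. a \<xi> * complex_of_real (ladder_pow i x y p (\<xi> + 0) (\<xi> + 0)))" for y
    unfolding ladder_kernel_def by (intro sum.mono_neutral_cong_right) (auto simp: finite_mi_ball)
  show ?case
    unfolding eq using 0(1) 0(2)[of 0] by (simp, intro order_trans[OF ladder_pow_L2[where \<alpha> = 0 and \<beta> = 0, simplified]])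
      (auto simp: finite_mi_ball)
next
  case (Suc t)
  let ?z = "\<lambda>y. complex_of_real (sqrt 2 * (x $ i - y $ i))"
  let ?N = "\<lambda>F. \<integral>\<^sup>+y. ennreal ((cmod (?z y ^ t * F y))\<^sup>2) \<partial>lborel"
  let ?S = "spectral_diag Q x"
  have supp: "\<xi> \<notin> mi_ball Q \<Longrightarrow> a \<xi> = 0" for \<xi>
    using Suc(2)[of \<xi>] by (auto simp: mi_ball_def)
  have 1: "ennreal (real Q ^ t) * ?N (ladder_kernel Q i (Suc p) (fdiff i a) x)
      \<le> ennreal (moment_const t (Suc p) * real Q ^ Suc p * (M / real Q)\<^sup>2 * ?S)"
  proof (rule Suc.IH)
    show "mi_abs \<xi> + t + Suc p \<le> Q" if "fdiff i a \<xi> \<noteq> 0" for \<xi>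
      using that Suc(2)[of \<xi>] Suc(2)[of "\<xi> + axis i 1"]
      by (cases "a \<xi> = 0") (auto simp: fdiff_def mi_abs_add mi_abs_axis)
    show "cmod ((fdiff i ^^ l) (fdiff i a) \<xi>) * real Q ^ l \<le> M / real Q" if "l \<le> t" for l \<xi>
      using Suc(3)[of "Suc l" \<xi>] that \<open>Q > 0\<close>
      by (simp add: funpow_Suc_right field_simps del: funpow.simps)
  qed
  have 2: "ennreal (real Q ^ t) * ?N (ladder_kernel Q i (p - 1) a x)
      \<le> ennreal (moment_const t (p - 1) * real Q ^ (p - 1) * M\<^sup>2 * ?S)"
    by (rule Suc.IH) (use Suc(2,3) in \<open>force+\<close>)
  have split: "?z y ^ Suc t * ladder_kernel Q i p a x y =
      ?z y ^ t * (2 * of_nat p * ladder_kernel Q i (p - 1) a x y) - ?z y ^ t * ladder_kernel Q i (Suc p) (fdiff i a) x y" for y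
  proof -
    have "?z y ^ Suc t * ladder_kernel Q i p a x y = ?z y ^ t * (?z y * ladder_kernel Q i p a x y)"
      by (simp only: power_Suc2 mult.assoc)
    also have "?z y * ladder_kernel Q i p a x y =
        2 * of_nat p * ladder_kernel Q i (p - 1) a x y - ladder_kernel Q i (Suc p) (fdiff i a) x y"
      by (rule mult_ladder_kernel[OF supp])
    finally show ?thesis
      by (simp only: right_diff_distrib[of "?z y ^ t"])
  qed
  have "ennreal (real Q ^ Suc t) * (\<integral>\<^sup>+y. ennreal ((cmod (?z y ^ Suc t * ladder_kernel Q i p a x y))\<^sup>2) \<partial>lborel)
    \<le> ennreal (real Q ^ Suc t) * (2 * ?N (\<lambda>y. 2 * of_nat p * ladder_kernel Q i (p - 1) a x y)
        + 2 * ?N (ladder_kernel Q i (Suc p) (fdiff i a) x))"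
    unfolding split
  proof (intro mult_left_mono nn_integral_cmod_square_diff)
    show "(\<lambda>y. ?z y ^ t * (2 * of_nat p * ladder_kernel Q i (p - 1) a x y)) \<in> borel_measurable lborel"
      by measurable
    show "(\<lambda>y. ?z y ^ t * ladder_kernel Q i (Suc p) (fdiff i a) x y) \<in> borel_measurable lborel"
      by measurable
  qed simp
  also have "?N (\<lambda>y. 2 * of_nat p * ladder_kernel Q i (p - 1) a x y) = ennreal (4 * (real p)\<^sup>2) * ?N (ladder_kernel Q i (p - 1) a x)"
    by (subst nn_integral_cmult[symmetric])
       (auto intro!: nn_integral_cong simp: norm_mult power_mult_distrib mult_ac simp flip: ennreal_mult'')
  also have "ennreal (real Q ^ Suc t) * (2 * (ennreal (4 * (real p)\<^sup>2) * ?N (ladder_kernel Q i (p - 1) a x))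
        + 2 * ?N (ladder_kernel Q i (Suc p) (fdiff i a) x))
     = ennreal (real Q) * (ennreal (8 * (real p)\<^sup>2) * (ennreal (real Q ^ t) * ?N (ladder_kernel Q i (p - 1) a x))
       + 2 * (ennreal (real Q ^ t) * ?N (ladder_kernel Q i (Suc p) (fdiff i a) x)))"
    by (simp add: ennreal_mult distrib_left mult_ac)
  also have "\<dots> \<le> ennreal (real Q) * (ennreal (8 * (real p)\<^sup>2) * ennreal (moment_const t (p - 1) * real Q ^ (p - 1) * M\<^sup>2 * ?S)
       + 2 * ennreal (moment_const t (Suc p) * real Q ^ Suc p * (M / real Q)\<^sup>2 * ?S))"
    by (intro mult_left_mono add_mono 1 2) simp_all
  also have "\<dots> = ennreal (real Q * (8 * (real p)\<^sup>2 * (moment_const t (p - 1) * real Q ^ (p - 1) * M\<^sup>2 * ?S)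
       + 2 * (moment_const t (Suc p) * real Q ^ Suc p * (M / real Q)\<^sup>2 * ?S)))"
    using moment_const_nonneg spectral_diag_nonneg[of Q x]
    by (simp add: ennreal_mult ennreal_plus)
  also have "\<dots> = ennreal (moment_const (Suc t) p * real Q ^ p * M\<^sup>2 * ?S)"
  proof -
    have q1: "real Q * ((real p)\<^sup>2 * real Q ^ (p - 1)) = (real p)\<^sup>2 * real Q ^ p"
      by (cases p) simp_all
    have q2: "real Q * (real Q ^ Suc p * (M / real Q)\<^sup>2) = real Q ^ p * M\<^sup>2"
      using \<open>Q > 0\<close> by (simp add: power2_eq_square)
    have "real Q * (8 * (real p)\<^sup>2 * (moment_const t (p - 1) * real Q ^ (p - 1) * M\<^sup>2 * ?S)
       + 2 * (moment_const t (Suc p) * real Q ^ Suc p * (M / real Q)\<^sup>2 * ?S))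
       = 8 * moment_const t (p - 1) * M\<^sup>2 * ?S * (real Q * ((real p)\<^sup>2 * real Q ^ (p - 1)))
         + 2 * moment_const t (Suc p) * ?S * (real Q * (real Q ^ Suc p * (M / real Q)\<^sup>2))"
      by (simp only: distrib_left mult_ac)
    then show ?thesis
      unfolding q1 q2 by (simp add: algebra_simps)
  qed
  finally show ?case .
qed

section \<open>A product weight\<close>

text \<open>
  The integrand is at most 1 on \<open>[-1, 1]\<close> and at most \<open>|u| powr (-1 - 1/n)\<close> outside, because \<open>2 N\<close> exceeds
  \<open>n\<close>. The two tails contribute \<open>n\<close> each.
\<close>

lemma nn_integral_weight_factor:
  assumes n: "n \<ge> 1" and N: "n + 1 \<le> 2 * N"
  shows "(\<integral>\<^sup>+u. ennreal ((1 + u ^ (2 * N)) powr (- 1 / real n)) \<partial>lborel) \<le> ennreal (2 + 2 * real n)"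
proof -
  let ?f = "\<lambda>u::real. (1 + u ^ (2 * N)) powr (- 1 / real n)"
  let ?g = "\<lambda>u::real. u powr (- 1 / real n - 1)"
  have tail: "?f u \<le> ?g u" if "1 \<le> u" for u
  proof -
    have "u ^ (n + 1) \<le> 1 + u ^ (2 * N)"
      using power_increasing[OF N that] by simp
    then have "?f u \<le> (u ^ (n + 1)) powr (- 1 / real n)"
      using that by (intro powr_mono2') auto
    also have "u ^ (n + 1) = u powr real (n + 1)"
      using that by (subst powr_realpow) auto
    also have "(u powr real (n + 1)) powr (- 1 / real n) = u powr (real (n + 1) * (- 1 / real n))"
      by (rule powr_powr)
    also have "real (n + 1) * (- 1 / real n) = - 1 / real n - 1"
      using n by (simp add: field_simps)
    finally show ?thesis .
  qed
  have "ennreal (?f u) \<le> indicator {-1..1} u + (ennreal (?g u) * indicator {1..} u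
       + ennreal (?g (- u)) * indicator {1..} (- u))" for u
  proof -
    consider "\<bar>u\<bar> \<le> 1" | "1 < u" | "1 < - u" by linarith
    then show ?thesis
    proof cases
      case 1
      have "?f u \<le> 1 powr (- 1 / real n)"
        by (intro powr_mono2') auto
      then have "ennreal (?f u) \<le> ennreal 1" by (intro ennreal_leI) simp
      also have "\<dots> = indicator {-1..1} u" using 1 by (auto simp: indicator_def abs_le_iff)
      finally show ?thesis by (rule add_increasing2[rotated]) simp
    next
      case 2
      then show ?thesis using tail[of u] by (simp add: ennreal_leI)
    next
      case 3
      then show ?thesis using tail[of "- u"] by (simp add: ennreal_leI)
    qed
  qed
  then have "(\<integral>\<^sup>+u. ennreal (?f u) \<partial>lborel) \<le> (\<integral>\<^sup>+u. indicator {-1..1} u + (ennreal (?g u) * indicator {1..} u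
       + ennreal (?g (- u)) * indicator {1..} (- u)) \<partial>lborel)"
    by (rule nn_integral_mono)
  also have "\<dots> = (\<integral>\<^sup>+u. indicator {-1..1::real} u \<partial>lborel) + ((\<integral>\<^sup>+u. ennreal (?g u) * indicator {1..} u \<partial>lborel)
       + (\<integral>\<^sup>+u. ennreal (?g (- u)) * indicator {1..} (- u) \<partial>lborel))"
  proof -
    have m: "(\<lambda>u. ennreal (?g u) * indicator {1..} u) \<in> borel_measurable lborel"
      by measurable
    have "(\<lambda>u. ennreal (?g (- u)) * indicator {1..} (- u)) \<in> borel_measurable lborel"
      using measurable_compose[of uminus lborel borel "\<lambda>u. ennreal (?g u) * indicator {1..} u" borel] m by simp
    with m show ?thesis
      by (simp add: nn_integral_add del: nn_integral_indicator)
  qed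
  also have "(\<integral>\<^sup>+u. ennreal (?g (- u)) * indicator {1..} (- u) \<partial>lborel) = (\<integral>\<^sup>+u. ennreal (?g u) * indicator {1..} u \<partial>lborel)"
    using nn_integral_real_affine[of "\<lambda>u. ennreal (?g u) * indicator {1..} u" "-1" 0] by simp
  also have "(\<integral>\<^sup>+u. ennreal (?g u) * indicator {1..} u \<partial>lborel) = ennreal (0 - (- real n * 1 powr (- 1 / real n)))"
  proof (rule nn_integral_FTC_atLeast[where F = "\<lambda>u. - real n * u powr (- 1 / real n)"])
    show "((\<lambda>u. - real n * u powr (- 1 / real n)) has_real_derivative ?g u) (at u)" if "1 \<le> u" for u
    proof -
      have "0 < u" using that by simp
      then have "((\<lambda>u. - real n * u powr (- 1 / real n)) has_real_derivative
          - real n * (- 1 / real n * u powr (- 1 / real n - 1))) (at u)"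
        by (intro DERIV_cmult has_real_derivative_powr)
      then show ?thesis using n by simp
    qed
    have "((\<lambda>u. u powr (- (1 / real n))) \<longlongrightarrow> 0) at_top"
      using n by (intro tendsto_neg_powr filterlim_ident) simp
    from tendsto_mult_right_zero[OF this, of "- real n"]
    show "((\<lambda>u. - real n * u powr (- 1 / real n)) \<longlongrightarrow> 0) at_top"
      by simp
  qed auto
  also have "(\<integral>\<^sup>+u. indicator {-1..1::real} u \<partial>lborel) = ennreal 2"
    by simp
  finally show ?thesis
    by (simp flip: ennreal_plus del: ennreal_numeral)
qed

text \<open>
  A substitute for the reciprocal of \<open>1 + Q\<^sup>N \<Sum>\<^sub>i |z\<^sub>i|\<^sup>2\<^sup>N\<close> that is a product of functions of one coordinate, so
  that its integral can be computed factor by factor.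
\<close>

definition decay_weight :: "nat \<Rightarrow> nat \<Rightarrow> real ^ 'n \<Rightarrow> real" where
  "decay_weight N Q z = (\<Prod>i\<in>UNIV. (1 + real Q ^ N * (z $ i) ^ (2 * N)) powr (- 1 / real CARD('n)))"

lemma decay_weight_measurable [measurable]: "decay_weight N Q \<in> borel_measurable borel"
  unfolding decay_weight_def by measurable

lemma decay_weight_base_pos: "0 < 1 + real Q ^ N * (z::real) ^ (2 * N)"
  by (intro add_pos_nonneg) (auto simp: power_mult)

lemma decay_weight_pos: "0 < decay_weight N Q z"
  unfolding decay_weight_def using decay_weight_base_pos by (intro prod_pos) (metis powr_gt_zero less_irrefl)

text \<open>
  The weight is the reciprocal of the geometric mean of \<open>n\<close> numbers, each of which is at most the second
  factor on the right.
\<close>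

lemma decay_weight_lower:
  fixes z :: "real ^ 'n"
  shows "1 \<le> decay_weight N Q z * (1 + (\<Sum>i\<in>UNIV. real Q ^ N * (z $ i) ^ (2 * N)))"
proof -
  define W where "W = 1 + (\<Sum>i\<in>UNIV. real Q ^ N * (z $ i) ^ (2 * N))"
  have nn: "0 \<le> real Q ^ N * (z $ i) ^ (2 * N)" for i
    by (simp add: power_mult)
  have "W > 0" unfolding W_def by (intro add_pos_nonneg sum_nonneg nn) simp
  have "W powr (- 1) = (\<Prod>i\<in>(UNIV::'n set). W powr (- 1 / real CARD('n)))"
    using \<open>W > 0\<close> by (simp add: powr_realpow[symmetric] powr_powr del: powr_realpow')
  also have "\<dots> \<le> decay_weight N Q z"
    unfolding decay_weight_def
  proof (intro prod_mono conjI powr_mono2' decay_weight_base_pos)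
    show "1 + real Q ^ N * (z $ i) ^ (2 * N) \<le> W" for i
      unfolding W_def by (intro add_left_mono member_le_sum nn) auto
  qed auto
  finally have "W powr (- 1) * W \<le> decay_weight N Q z * W"
    using \<open>W > 0\<close> by (intro mult_right_mono) auto
  moreover have "W powr (- 1) * W = 1" using \<open>W > 0\<close> by (simp add: powr_minus)
  ultimately show ?thesis by (simp add: W_def)
qed

text \<open>
  Rescaling each coordinate by \<open>sqrt Q\<close> reduces this to the case \<open>Q = 1\<close>.
\<close>

lemma nn_integral_decay_weight:
  assumes Q: "Q > 0" and N: "CARD('n) + 1 \<le> 2 * N"
  shows "(\<integral>\<^sup>+z. ennreal (decay_weight N Q z) \<partial>(lborel :: (real ^ 'n) measure))
     \<le> ennreal (((2 + 2 * real CARD('n)) / sqrt (real Q)) ^ CARD('n))"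
proof -
  let ?p = "- 1 / real CARD('n)"
  have fac: "(\<integral>\<^sup>+t. ennreal ((1 + real Q ^ N * t ^ (2 * N)) powr ?p) \<partial>lborel)
      \<le> ennreal ((2 + 2 * real CARD('n)) / sqrt (real Q))"
  proof -
    have "(\<integral>\<^sup>+u. ennreal ((1 + u ^ (2 * N)) powr ?p) \<partial>lborel)
       = ennreal \<bar>sqrt (real Q)\<bar> * (\<integral>\<^sup>+t. ennreal ((1 + (0 + sqrt (real Q) * t) ^ (2 * N)) powr ?p) \<partial>lborel)"
      by (rule nn_integral_real_affine) (use Q in auto)
    also have "(\<lambda>t. (0 + sqrt (real Q) * t) ^ (2 * N)) = (\<lambda>t. real Q ^ N * t ^ (2 * N))"
      by (simp add: power_mult power_mult_distrib)
    finally have "ennreal (sqrt (real Q)) * (\<integral>\<^sup>+t. ennreal ((1 + real Q ^ N * t ^ (2 * N)) powr ?p) \<partial>lborel)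
        \<le> ennreal (2 + 2 * real CARD('n))"
      using nn_integral_weight_factor[of "CARD('n)" N] N by (simp add: Suc_leI)
    then have "ennreal (1 / sqrt (real Q)) * (ennreal (sqrt (real Q)) * (\<integral>\<^sup>+t. ennreal ((1 + real Q ^ N * t ^ (2 * N)) powr ?p) \<partial>lborel))
       \<le> ennreal (1 / sqrt (real Q)) * ennreal (2 + 2 * real CARD('n))"
      by (intro mult_left_mono) auto
    also have "\<dots> = ennreal ((2 + 2 * real CARD('n)) / sqrt (real Q))"
      by (subst ennreal_mult[symmetric]) auto
    also have "ennreal (1 / sqrt (real Q)) * (ennreal (sqrt (real Q)) * I) = I" for I
    proof -
      have "ennreal (1 / sqrt (real Q)) * ennreal (sqrt (real Q)) = 1"
        using Q by (subst ennreal_mult[symmetric]) auto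
      then show ?thesis by (simp add: mult.assoc[symmetric])
    qed
    finally show ?thesis .
  qed
  have "(\<integral>\<^sup>+z. ennreal (decay_weight N Q z) \<partial>(lborel :: (real ^ 'n) measure))
    = (\<integral>\<^sup>+z. (\<Prod>i\<in>UNIV. ennreal ((1 + real Q ^ N * (z $ i) ^ (2 * N)) powr ?p)) \<partial>(lborel :: (real ^ 'n) measure))"
    unfolding decay_weight_def by (subst prod_ennreal) auto
  also have "\<dots> = (\<Prod>i\<in>(UNIV::'n set). (\<integral>\<^sup>+t. ennreal ((1 + real Q ^ N * t ^ (2 * N)) powr ?p) \<partial>lborel))"
    by (rule nn_integral_prod_coordinates) measurable
  also have "\<dots> \<le> (\<Prod>i\<in>(UNIV::'n set). ennreal ((2 + 2 * real CARD('n)) / sqrt (real Q)))"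
    by (intro prod_mono_ennreal fac)
  also have "\<dots> = ennreal (((2 + 2 * real CARD('n)) / sqrt (real Q)) ^ CARD('n))"
    by (simp add: ennreal_power)
  finally show ?thesis .
qed

section \<open>A single frequency-localized piece\<close>

lemma integrable_mult_of_square_integrable:
  fixes g :: "'a \<Rightarrow> complex" and h :: "'a \<Rightarrow> real"
  assumes [measurable]: "g \<in> borel_measurable M" "h \<in> borel_measurable M"
    and "integrable M (\<lambda>x. (cmod (g x))\<^sup>2)" "integrable M (\<lambda>x. h x * h x)"
  shows "integrable M (\<lambda>x. g x * complex_of_real (h x))"
proof (rule Bochner_Integration.integrable_bound)
  show "integrable M (\<lambda>x. (cmod (g x))\<^sup>2 + h x * h x)"
    using assms by simp
  have "cmod (g x) * \<bar>h x\<bar> \<le> (cmod (g x))\<^sup>2 + h x * h x" for x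
  proof -
    have "0 \<le> cmod (g x) * \<bar>h x\<bar>" by simp
    with sum_squares_bound[of "cmod (g x)" "\<bar>h x\<bar>"]
    have "cmod (g x) * \<bar>h x\<bar> \<le> (cmod (g x))\<^sup>2 + \<bar>h x\<bar>\<^sup>2" by linarith
    then show ?thesis by (simp add: power2_eq_square)
  qed
  then show "AE x in M. norm (g x * complex_of_real (h x)) \<le> norm ((cmod (g x))\<^sup>2 + h x * h x)"
    by (auto simp: norm_mult intro!: always_eventually order_trans[OF _ abs_ge_self])
qed measurable

lemma integrable_hermite_fun_square: "integrable lborel (\<lambda>x. hermite_fun \<xi> x * hermite_fun \<xi> x)"
  using hermite_fun_orthonormal[of \<xi> \<xi>] by (simp add: has_bochner_integral_iff)

text \<open>
  One term for the unweighted norm of the kernel and one for each of the \<open>n\<close> coordinate moments.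
\<close>

definition piece_const :: "nat \<Rightarrow> nat \<Rightarrow> real" where
  "piece_const n N = 1 + real n * moment_const N 0"

lemma kernel_weighted_L2:
  fixes a :: "nat ^ 'n \<Rightarrow> complex"
  assumes Q: "Q > 0" and supp: "\<And>\<xi>. a \<xi> \<noteq> 0 \<Longrightarrow> mi_abs \<xi> + N \<le> Q"
    and bd: "\<And>i l \<xi>. l \<le> N \<Longrightarrow> cmod ((fdiff i ^^ l) a \<xi>) * real Q ^ l \<le> M"
  shows "(\<integral>\<^sup>+y. ennreal ((cmod (\<Sum>\<xi>\<in>mi_ball Q. a \<xi> * complex_of_real (hermite_fun \<xi> x) * complex_of_real (hermite_fun \<xi> y)))\<^sup>2
        / decay_weight N Q (x - y)) \<partial>lborel)
     \<le> ennreal (piece_const CARD('n) N * M\<^sup>2 * spectral_diag Q x)"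
proof -
  define K where "K y = (\<Sum>\<xi>\<in>mi_ball Q. a \<xi> * complex_of_real (hermite_fun \<xi> x) * complex_of_real (hermite_fun \<xi> y))" for y
  have K: "K y = ladder_kernel Q i 0 a x y" for y i
    by (simp add: K_def ladder_kernel_def mult.assoc)
  have [measurable]: "K \<in> borel_measurable borel" unfolding K_def by measurable
  let ?Z = "\<lambda>i y. (cmod (complex_of_real (sqrt 2 * (x $ i - y $ i)) ^ N * K y))\<^sup>2"
  have pt: "(cmod (K y))\<^sup>2 / decay_weight N Q (x - y) \<le> (cmod (K y))\<^sup>2 + (\<Sum>i\<in>UNIV. real Q ^ N * ?Z i y)" for y
  proof -
    let ?w = "decay_weight N Q (x - y)"
    have "1 / ?w \<le> 1 + (\<Sum>i\<in>UNIV. real Q ^ N * ((x - y) $ i) ^ (2 * N))"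
      using decay_weight_lower[of N Q "x - y"] decay_weight_pos[of N Q "x - y"] by (simp add: divide_simps mult.commute)
    also have "\<dots> \<le> 1 + (\<Sum>i\<in>UNIV. real Q ^ N * (sqrt 2 * (x $ i - y $ i)) ^ (2 * N))"
    proof (intro add_left_mono sum_mono mult_left_mono)
      show "((x - y) $ i) ^ (2 * N) \<le> (sqrt 2 * (x $ i - y $ i)) ^ (2 * N)" for i
        unfolding power_mult by (rule power_mono) (auto simp: power_mult_distrib)
    qed simp
    finally have "(cmod (K y))\<^sup>2 * (1 / ?w) \<le> (cmod (K y))\<^sup>2 * (1 + (\<Sum>i\<in>UNIV. real Q ^ N * (sqrt 2 * (x $ i - y $ i)) ^ (2 * N)))"
      by (rule mult_left_mono) simp
    also have "\<dots> = (cmod (K y))\<^sup>2 + (\<Sum>i\<in>UNIV. real Q ^ N * ?Z i y)"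
    proof -
      have "(cmod (complex_of_real r ^ N * k))\<^sup>2 = (cmod k)\<^sup>2 * r ^ (2 * N)" for r k
      proof -
        have "(cmod (complex_of_real r ^ N * k))\<^sup>2 = (\<bar>r\<bar>\<^sup>2) ^ N * (cmod k)\<^sup>2"
          by (simp only: norm_mult norm_power norm_of_real power_mult_distrib power_mult[symmetric] mult.commute)
        then show ?thesis
          unfolding power_mult power2_abs by (simp only: mult.commute)
      qed
      then show ?thesis
        by (simp only: distrib_left sum_distrib_left mult_1_right mult.left_commute)
    qed
    finally show ?thesis by simp
  qed
  \<comment> \<open>Without ladder factors the kernel is the same for every coordinate, so an arbitrary one is chosen.\<close>
  have 0: "(\<integral>\<^sup>+y. ennreal ((cmod (K y))\<^sup>2) \<partial>lborel) \<le> ennreal (M\<^sup>2 * spectral_diag Q x)"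
  proof -
    have "ennreal (real Q ^ 0) * (\<integral>\<^sup>+y. ennreal ((cmod (complex_of_real (sqrt 2 * (x $ undefined - y $ undefined)) ^ 0
        * ladder_kernel Q undefined 0 a x y))\<^sup>2) \<partial>lborel) \<le> ennreal (moment_const 0 0 * real Q ^ 0 * M\<^sup>2 * spectral_diag Q x)"
    proof (rule ladder_kernel_weighted_L2[OF Q])
      show "mi_abs \<xi> + 0 + 0 \<le> Q" if "a \<xi> \<noteq> 0" for \<xi>
        using supp[OF that] by simp
      show "cmod ((fdiff undefined ^^ l) a \<xi>) * real Q ^ l \<le> M" if "l \<le> 0" for l \<xi>
        using bd[of 0 undefined \<xi>] that by simp
    qed
    then show ?thesis by (simp add: K[of _ undefined, symmetric])
  qed
  have i: "ennreal (real Q ^ N) * (\<integral>\<^sup>+y. ennreal (?Z i y) \<partial>lborel) \<le> ennreal (moment_const N 0 * M\<^sup>2 * spectral_diag Q x)" for i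
    using ladder_kernel_weighted_L2[of Q a N 0 i M x] Q supp bd
    by (simp add: K[of _ i, symmetric])
  have "(\<integral>\<^sup>+y. ennreal ((cmod (K y))\<^sup>2 / decay_weight N Q (x - y)) \<partial>lborel)
     \<le> (\<integral>\<^sup>+y. ennreal ((cmod (K y))\<^sup>2) + (\<Sum>i\<in>UNIV. ennreal (real Q ^ N) * ennreal (?Z i y)) \<partial>lborel)"
  proof (rule nn_integral_mono)
    fix y
    have "ennreal ((cmod (K y))\<^sup>2 / decay_weight N Q (x - y)) \<le> ennreal ((cmod (K y))\<^sup>2 + (\<Sum>i\<in>UNIV. real Q ^ N * ?Z i y))"
      by (rule ennreal_leI[OF pt])
    also have "\<dots> = ennreal ((cmod (K y))\<^sup>2) + (\<Sum>i\<in>UNIV. ennreal (real Q ^ N) * ennreal (?Z i y))"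
      by (subst ennreal_plus) (auto intro!: sum_nonneg simp: sum_ennreal[symmetric] ennreal_mult simp del: sum_ennreal)
    finally show "ennreal ((cmod (K y))\<^sup>2 / decay_weight N Q (x - y)) \<le> ennreal ((cmod (K y))\<^sup>2) + (\<Sum>i\<in>UNIV. ennreal (real Q ^ N) * ennreal (?Z i y))" .
  qed
  also have "\<dots> = (\<integral>\<^sup>+y. ennreal ((cmod (K y))\<^sup>2) \<partial>lborel) + (\<Sum>i\<in>UNIV. ennreal (real Q ^ N) * (\<integral>\<^sup>+y. ennreal (?Z i y) \<partial>lborel))"
    by (simp add: nn_integral_add nn_integral_sum nn_integral_cmult)
  also have "\<dots> \<le> ennreal (M\<^sup>2 * spectral_diag Q x) + (\<Sum>i\<in>(UNIV::'n set). ennreal (moment_const N 0 * M\<^sup>2 * spectral_diag Q x))"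
    by (intro add_mono sum_mono 0 i)
  also have "\<dots> = ennreal (piece_const CARD('n) N * M\<^sup>2 * spectral_diag Q x)"
    using moment_const_nonneg[of N 0] spectral_diag_nonneg[of Q x]
    by (subst sum_ennreal) (auto simp: piece_const_def algebra_simps simp flip: ennreal_plus)
  finally show ?thesis unfolding K_def .
qed

text \<open>
  The left-hand side is the value at \<open>x\<close> of an integral operator. The Cauchy-Schwarz inequality with the
  weight distributed over both factors separates the moments of the kernel from a convolution of
  \<open>|g|\<^sup>2\<close> with the weight.
\<close>

lemma pseudo_mult_piece_pointwise:
  fixes a :: "nat ^ 'n \<Rightarrow> complex" and g :: "real ^ 'n \<Rightarrow> complex"
  assumes Q: "Q > 0" and supp: "\<And>\<xi>. a \<xi> \<noteq> 0 \<Longrightarrow> mi_abs \<xi> + N \<le> Q"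
    and bd: "\<And>i l \<xi>. l \<le> N \<Longrightarrow> cmod ((fdiff i ^^ l) a \<xi>) * real Q ^ l \<le> M"
    and [measurable]: "g \<in> borel_measurable borel" and g: "integrable lborel (\<lambda>x. (cmod (g x))\<^sup>2)"
  shows "ennreal ((cmod (\<Sum>\<xi>\<in>mi_ball Q. a \<xi> * (LINT y|lborel. g y * complex_of_real (hermite_fun \<xi> y)) * complex_of_real (hermite_fun \<xi> x)))\<^sup>2)
    \<le> ennreal (piece_const CARD('n) N * M\<^sup>2 * (2 * sqrt (real Q)) ^ CARD('n))
        * (\<integral>\<^sup>+y. ennreal ((cmod (g y))\<^sup>2 * decay_weight N Q (x - y)) \<partial>lborel)"
proof -
  define K where "K y = (\<Sum>\<xi>\<in>mi_ball Q. a \<xi> * complex_of_real (hermite_fun \<xi> x) * complex_of_real (hermite_fun \<xi> y))" for y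
  let ?w = "\<lambda>y. decay_weight N Q (x - y)"
  have [measurable]: "K \<in> borel_measurable borel" unfolding K_def by measurable
  have [simp]: "?w y \<ge> 0" "?w y > 0" "?w y \<noteq> 0" for y
    using decay_weight_pos[of N Q "x - y"] by auto
  have int: "integrable lborel (\<lambda>y. (a \<xi> * complex_of_real (hermite_fun \<xi> x)) * (g y * complex_of_real (hermite_fun \<xi> y)))" for \<xi>
    by (intro integrable_mult_right integrable_mult_of_square_integrable integrable_hermite_fun_square)
       (use g in auto)
  have gK: "g y * K y = (\<Sum>\<xi>\<in>mi_ball Q. (a \<xi> * complex_of_real (hermite_fun \<xi> x)) * (g y * complex_of_real (hermite_fun \<xi> y)))" for y
    unfolding K_def sum_distrib_left by (intro sum.cong refl) (simp add: mult_ac)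
  have "(\<Sum>\<xi>\<in>mi_ball Q. a \<xi> * (LINT y|lborel. g y * complex_of_real (hermite_fun \<xi> y)) * complex_of_real (hermite_fun \<xi> x))
     = (LINT y|lborel. g y * K y)"
    unfolding gK Bochner_Integration.integral_sum[OF int] integral_mult_right_zero
    by (intro sum.cong refl) (simp only: mult_ac)
  moreover have "integrable lborel (\<lambda>y. g y * K y)"
    unfolding gK by (intro Bochner_Integration.integrable_sum int)
  ultimately have "ennreal (cmod (\<Sum>\<xi>\<in>mi_ball Q. a \<xi> * (LINT y|lborel. g y * complex_of_real (hermite_fun \<xi> y)) * complex_of_real (hermite_fun \<xi> x)))
     \<le> (\<integral>\<^sup>+y. ennreal (cmod (g y * K y)) \<partial>lborel)"
    using integral_norm_bound_ennreal[of lborel "\<lambda>y. g y * K y"] by simp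
  also have "\<dots> = (\<integral>\<^sup>+y. ennreal (cmod (g y) * sqrt (?w y)) * ennreal (cmod (K y) / sqrt (?w y)) \<partial>lborel)"
    by (intro nn_integral_cong) (simp add: norm_mult flip: ennreal_mult)
  finally have "(ennreal (cmod (\<Sum>\<xi>\<in>mi_ball Q. a \<xi> * (LINT y|lborel. g y * complex_of_real (hermite_fun \<xi> y)) * complex_of_real (hermite_fun \<xi> x))))\<^sup>2
     \<le> (\<integral>\<^sup>+y. ennreal (cmod (g y) * sqrt (?w y)) * ennreal (cmod (K y) / sqrt (?w y)) \<partial>lborel)\<^sup>2"
    by (intro power_mono) auto
  also have "\<dots> \<le> (\<integral>\<^sup>+y. (ennreal (cmod (g y) * sqrt (?w y)))\<^sup>2 \<partial>lborel) * (\<integral>\<^sup>+y. (ennreal (cmod (K y) / sqrt (?w y)))\<^sup>2 \<partial>lborel)"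
    by (rule Cauchy_Schwarz_nn_integral) measurable
  also have "\<dots> = (\<integral>\<^sup>+y. ennreal ((cmod (g y))\<^sup>2 * ?w y) \<partial>lborel) * (\<integral>\<^sup>+y. ennreal ((cmod (K y))\<^sup>2 / ?w y) \<partial>lborel)"
    by (simp add: ennreal_power power_mult_distrib power_divide)
  also have "\<dots> \<le> (\<integral>\<^sup>+y. ennreal ((cmod (g y))\<^sup>2 * ?w y) \<partial>lborel) * ennreal (piece_const CARD('n) N * M\<^sup>2 * spectral_diag Q x)"
    unfolding K_def by (intro mult_left_mono kernel_weighted_L2 Q supp bd) auto
  also have "\<dots> \<le> (\<integral>\<^sup>+y. ennreal ((cmod (g y))\<^sup>2 * ?w y) \<partial>lborel) * ennreal (piece_const CARD('n) N * M\<^sup>2 * (2 * sqrt (real Q)) ^ CARD('n))"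
  proof (intro mult_left_mono ennreal_leI)
    have "sqrt (2 * real (Suc Q)) \<le> sqrt (4 * real Q)" using Q by (intro real_sqrt_le_mono) auto
    also have "\<dots> = 2 * sqrt (real Q)" by (simp add: real_sqrt_mult)
    finally have "sqrt (2 * real (Suc Q)) ^ CARD('n) \<le> (2 * sqrt (real Q)) ^ CARD('n)" by (intro power_mono) auto
    then show "spectral_diag Q x \<le> (2 * sqrt (real Q)) ^ CARD('n)"
      using spectral_diag_le[of Q x] by linarith
    show "0 \<le> piece_const CARD('n) N * M\<^sup>2" using moment_const_nonneg[of N 0] by (simp add: piece_const_def)
  qed simp
  finally show ?thesis by (simp add: ennreal_power mult.commute)
qed

lemma nn_integral_convolution_decay:
  fixes F :: "real ^ 'n \<Rightarrow> real"
  assumes [measurable]: "F \<in> borel_measurable borel" and F: "\<And>y. F y \<ge> 0" and Q: "Q > 0" and N: "CARD('n) + 1 \<le> 2 * N"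
  shows "(\<integral>\<^sup>+x. (\<integral>\<^sup>+y. ennreal (F y * decay_weight N Q (x - y)) \<partial>lborel) \<partial>lborel)
    \<le> ennreal (((2 + 2 * real CARD('n)) / sqrt (real Q)) ^ CARD('n)) * (\<integral>\<^sup>+y. ennreal (F y) \<partial>lborel)"
proof -
  have "(\<integral>\<^sup>+x. (\<integral>\<^sup>+y. ennreal (F y * decay_weight N Q (x - y)) \<partial>lborel) \<partial>lborel)
     = (\<integral>\<^sup>+y. (\<integral>\<^sup>+x. ennreal (F y * decay_weight N Q (x - y)) \<partial>lborel) \<partial>lborel)"
    by (rule lborel_pair.Fubini'[symmetric]) measurable
  also have "\<dots> \<le> (\<integral>\<^sup>+y. ennreal (((2 + 2 * real CARD('n)) / sqrt (real Q)) ^ CARD('n)) * ennreal (F y) \<partial>lborel)"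
  proof (rule nn_integral_mono)
    fix y
    have "(\<integral>\<^sup>+x. ennreal (F y * decay_weight N Q (x - y)) \<partial>lborel) = ennreal (F y) * (\<integral>\<^sup>+x. ennreal (decay_weight N Q (x - y)) \<partial>lborel)"
      using F[of y] by (subst nn_integral_cmult[symmetric]) (auto simp: ennreal_mult' )
    also have "(\<integral>\<^sup>+x. ennreal (decay_weight N Q (x - y)) \<partial>lborel) = (\<integral>\<^sup>+x. ennreal (decay_weight N Q x) \<partial>distr lborel borel (\<lambda>x. - y + x))"
      by (subst nn_integral_distr) auto
    also have "\<dots> = (\<integral>\<^sup>+x. ennreal (decay_weight N Q x) \<partial>(lborel :: (real ^ 'n) measure))"
      unfolding lborel_distr_plus by (rule refl)
    also have "ennreal (F y) * \<dots> \<le> ennreal (F y) * ennreal (((2 + 2 * real CARD('n)) / sqrt (real Q)) ^ CARD('n))"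
      by (intro mult_left_mono nn_integral_decay_weight Q N) simp
    finally show "(\<integral>\<^sup>+x. ennreal (F y * decay_weight N Q (x - y)) \<partial>lborel)
      \<le> ennreal (((2 + 2 * real CARD('n)) / sqrt (real Q)) ^ CARD('n)) * ennreal (F y)"
      by (simp add: mult.commute)
  qed
  also have "\<dots> = ennreal (((2 + 2 * real CARD('n)) / sqrt (real Q)) ^ CARD('n)) * (\<integral>\<^sup>+y. ennreal (F y) \<partial>lborel)"
    by (rule nn_integral_cmult) simp
  finally show ?thesis .
qed

text \<open>
  Tonelli's theorem is applied to Borel functions on \<open>lborel\<close>, whereas elements of \<open>L2\<close> are only Lebesgue
  measurable. Passing to a Borel representative changes neither norm nor coefficients.
\<close>

lemma L2_borel_representative:
  fixes f :: "real ^ 'n \<Rightarrow> complex"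
  assumes f: "f \<in> L2"
  obtains g where "g \<in> borel_measurable borel" "integrable lborel (\<lambda>x. (cmod (g x))\<^sup>2)"
    "(\<integral>\<^sup>+x. ennreal ((cmod (g x))\<^sup>2) \<partial>lborel) = ennreal ((L2_norm f)\<^sup>2)"
    "\<And>\<xi>. hermite_coeff f \<xi> = (LINT x|lborel. g x * complex_of_real (hermite_fun \<xi> x))"
proof -
  have fm [measurable]: "f \<in> borel_measurable lebesgue" and fi: "integrable lebesgue (\<lambda>x. (cmod (f x))\<^sup>2)"
    using f by (auto simp: L2_def)
  obtain u where u [measurable]: "u \<in> borel_measurable lborel" and ur: "AE x in lborel. Re (f x) = u x"
    using completion_ex_borel_measurable_real[of "\<lambda>x. Re (f x)" lborel] by auto
  obtain v where v [measurable]: "v \<in> borel_measurable lborel" and vr: "AE x in lborel. Im (f x) = v x"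
    using completion_ex_borel_measurable_real[of "\<lambda>x. Im (f x)" lborel] by auto
  define g where "g x = Complex (u x) (v x)" for x
  have gm [measurable]: "g \<in> borel_measurable borel"
    unfolding g_def Complex_eq using u v by measurable
  have fg: "AE x in lebesgue. f x = g x"
    using ur vr by (intro AE_completion) (auto simp: g_def complex_eq_iff)
  have gi': "integrable lebesgue (\<lambda>x. (cmod (g x))\<^sup>2)"
    using fi by (rule integrable_cong_AE_imp) (use fg in \<open>auto intro: measurable_completion\<close>)
  then have gi: "integrable lborel (\<lambda>x. (cmod (g x))\<^sup>2)"
    by (subst (asm) integrable_completion) auto
  have "(\<integral>\<^sup>+x. ennreal ((cmod (g x))\<^sup>2) \<partial>lborel) = (\<integral>\<^sup>+x. ennreal ((cmod (g x))\<^sup>2) \<partial>lebesgue)"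
    by (rule nn_integral_completion[symmetric])
  also have "\<dots> = (\<integral>\<^sup>+x. ennreal ((cmod (f x))\<^sup>2) \<partial>lebesgue)"
    by (rule nn_integral_cong_AE) (use fg in auto)
  also have "\<dots> = ennreal ((L2_norm f)\<^sup>2)"
    using fi by (simp add: nn_integral_eq_integral L2_norm_def)
  finally have gn: "(\<integral>\<^sup>+x. ennreal ((cmod (g x))\<^sup>2) \<partial>lborel) = ennreal ((L2_norm f)\<^sup>2)" .
  have hm [measurable]: "hermite_fun \<xi> \<in> borel_measurable lebesgue" for \<xi> :: "nat ^ 'n"
    by (rule measurable_completion) simp
  have gml [measurable]: "g \<in> borel_measurable lebesgue"
    by (rule measurable_completion) simp
  have "hermite_coeff f \<xi> = (LINT x|lborel. g x * complex_of_real (hermite_fun \<xi> x))" for \<xi>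
  proof -
    have "hermite_coeff f \<xi> = (LINT x|lebesgue. g x * complex_of_real (hermite_fun \<xi> x))"
      unfolding hermite_coeff_def by (rule integral_cong_AE) (use fg in \<open>auto intro!: borel_measurable_times\<close>)
    also have "\<dots> = (LINT x|lborel. g x * complex_of_real (hermite_fun \<xi> x))"
      by (rule integral_completion) measurable
    finally show ?thesis .
  qed
  with gm gi gn show thesis by (intro that)
qed

text \<open>
  The diagonal bound contributes \<open>Q powr (n / 2)\<close> and the integral of the weight \<open>Q powr (- n / 2)\<close>, so the
  constant does not depend on \<open>Q\<close>.
\<close>

lemma pseudo_mult_piece_bound:
  fixes b :: "real ^ 'n \<Rightarrow> nat ^ 'n \<Rightarrow> complex"
  assumes Q: "Q > 0" and N: "CARD('n) + 1 \<le> 2 * N" and f: "f \<in> L2"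
    and supp: "\<And>x \<xi>. b x \<xi> \<noteq> 0 \<Longrightarrow> mi_abs \<xi> + N \<le> Q"
    and bd: "AE x in lebesgue. \<forall>i \<xi>. \<forall>l\<le>N. cmod ((fdiff i ^^ l) (b x) \<xi>) * real Q ^ l \<le> M"
  shows "(\<integral>\<^sup>+x. ennreal ((cmod (\<Sum>\<xi>\<in>mi_ball Q. b x \<xi> * hermite_coeff f \<xi> * complex_of_real (hermite_fun \<xi> x)))\<^sup>2) \<partial>lebesgue)
    \<le> ennreal (piece_const CARD('n) N * (4 + 4 * real CARD('n)) ^ CARD('n) * M\<^sup>2 * (L2_norm f)\<^sup>2)"
proof -
  obtain g where [measurable]: "g \<in> borel_measurable borel" and gi: "integrable lborel (\<lambda>x. (cmod (g x))\<^sup>2)"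
    and gn: "(\<integral>\<^sup>+x. ennreal ((cmod (g x))\<^sup>2) \<partial>lborel) = ennreal ((L2_norm f)\<^sup>2)"
    and gc: "\<And>\<xi>. hermite_coeff f \<xi> = (LINT x|lborel. g x * complex_of_real (hermite_fun \<xi> x))"
    using L2_borel_representative[OF f] by blast
  let ?A = "piece_const CARD('n) N * M\<^sup>2 * (2 * sqrt (real Q)) ^ CARD('n)"
  let ?B = "((2 + 2 * real CARD('n)) / sqrt (real Q)) ^ CARD('n)"
  have pc: "piece_const CARD('n) N \<ge> 0" using moment_const_nonneg[of N 0] by (simp add: piece_const_def)
  have "(\<integral>\<^sup>+x. ennreal ((cmod (\<Sum>\<xi>\<in>mi_ball Q. b x \<xi> * hermite_coeff f \<xi> * complex_of_real (hermite_fun \<xi> x)))\<^sup>2) \<partial>lebesgue)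
    \<le> (\<integral>\<^sup>+x. ennreal ?A * (\<integral>\<^sup>+y. ennreal ((cmod (g y))\<^sup>2 * decay_weight N Q (x - y)) \<partial>lborel) \<partial>lebesgue)"
  proof (rule nn_integral_mono_AE, use bd in eventually_elim)
    case (elim x)
    show ?case
      unfolding gc by (rule pseudo_mult_piece_pointwise) (use Q supp elim gi in auto)
  qed
  also have "\<dots> = (\<integral>\<^sup>+x. ennreal ?A * (\<integral>\<^sup>+y. ennreal ((cmod (g y))\<^sup>2 * decay_weight N Q (x - y)) \<partial>lborel) \<partial>lborel)"
    by (rule nn_integral_completion)
  also have "\<dots> = ennreal ?A * (\<integral>\<^sup>+x. (\<integral>\<^sup>+y. ennreal ((cmod (g y))\<^sup>2 * decay_weight N Q (x - y)) \<partial>lborel) \<partial>lborel)"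
    by (rule nn_integral_cmult) measurable
  also have "\<dots> \<le> ennreal ?A * (ennreal ?B * ennreal ((L2_norm f)\<^sup>2))"
    unfolding gn[symmetric] by (intro mult_left_mono nn_integral_convolution_decay Q N) auto
  also have "\<dots> = ennreal (?A * ?B * (L2_norm f)\<^sup>2)"
    using pc by (simp add: ennreal_mult mult.assoc)
  also have "?A * ?B = piece_const CARD('n) N * (4 + 4 * real CARD('n)) ^ CARD('n) * M\<^sup>2"
  proof -
    have "(2 * sqrt (real Q)) ^ CARD('n) * ?B = (4 + 4 * real CARD('n)) ^ CARD('n)"
    proof -
      have "2 * sqrt (real Q) * ((2 + 2 * real CARD('n)) / sqrt (real Q)) = 4 + 4 * real CARD('n)"
        using Q by (simp add: field_simps)
      then show ?thesis unfolding power_mult_distrib[symmetric] by simp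
    qed
    then show ?thesis by (simp only: mult_ac)
  qed
  finally show ?thesis .
qed

section \<open>Dyadic cutoffs with controlled differences\<close>

definition ndiff :: "(nat \<Rightarrow> real) \<Rightarrow> nat \<Rightarrow> real" where
  "ndiff g s = g (Suc s) - g s"

definition forward_avg :: "nat \<Rightarrow> (nat \<Rightarrow> real) \<Rightarrow> nat \<Rightarrow> real" where
  "forward_avg R g s = (\<Sum>j<R. g (s + j)) / real R"

lemma ndiff_forward_avg: "ndiff (forward_avg R g) = (\<lambda>s. (g (s + R) - g s) / real R)"
proof
  fix s
  have "(\<Sum>j<R. g (Suc s + j)) - (\<Sum>j<R. g (s + j)) = (\<Sum>j<R. g (s + Suc j) - g (s + j))"
    by (simp add: sum_subtractf)
  also have "\<dots> = g (s + R) - g s"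
    using sum_lessThan_telescope[of "\<lambda>j. g (s + j)" R] by simp
  finally show "ndiff (forward_avg R g) s = (g (s + R) - g s) / real R"
    by (simp add: ndiff_def forward_avg_def flip: diff_divide_distrib)
qed

lemma ndiff_funpow_lincomb:
  "(ndiff ^^ l) (\<lambda>s. (g (s + a) - h (s + b)) / c) s = ((ndiff ^^ l) g (s + a) - (ndiff ^^ l) h (s + b)) / c"
proof (induction l arbitrary: s)
  case (Suc l)
  then show ?case
    by (simp add: ndiff_def diff_divide_distrib)
qed simp

text \<open>
  A difference of a moving average telescopes to a difference quotient with step \<open>R\<close>, so each average
  makes one more order of differences bounded at scale \<open>R\<close>.
\<close>

lemma forward_avg_gain:
  assumes R: "R > 0" and "\<And>l s. l \<le> k \<Longrightarrow> \<bar>(ndiff ^^ l) g s\<bar> \<le> (2 / real R) ^ l" and l: "l \<le> Suc k"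
  shows "\<bar>(ndiff ^^ l) (forward_avg R g) s\<bar> \<le> (2 / real R) ^ l"
proof (cases l)
  case 0
  have "\<bar>\<Sum>j<R. g (s + j)\<bar> \<le> (\<Sum>j<R. 1)"
    using assms(2)[of 0] by (intro order_trans[OF sum_abs] sum_mono) auto
  then show ?thesis using R 0 by (simp add: forward_avg_def)
next
  case (Suc q)
  then have "q \<le> k" using l by simp
  have "(ndiff ^^ l) (forward_avg R g) s = (ndiff ^^ q) (ndiff (forward_avg R g)) s"
    by (simp add: Suc funpow_Suc_right del: funpow.simps)
  also have "\<dots> = ((ndiff ^^ q) g (s + R) - (ndiff ^^ q) g s) / real R"
    unfolding ndiff_forward_avg using ndiff_funpow_lincomb[of q g R g 0 "real R" s] by simp
  finally have "\<bar>(ndiff ^^ l) (forward_avg R g) s\<bar> = \<bar>(ndiff ^^ q) g (s + R) - (ndiff ^^ q) g s\<bar> / real R"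
    by simp
  also have "\<dots> \<le> ((2 / real R) ^ q + (2 / real R) ^ q) / real R"
    using assms(2)[OF \<open>q \<le> k\<close>, of "s + R"] assms(2)[OF \<open>q \<le> k\<close>, of s] by (intro divide_right_mono) auto
  also have "\<dots> = (2 / real R) ^ l"
    by (simp add: Suc field_simps)
  finally show ?thesis .
qed

lemma forward_avg_eq_0: "(\<And>s. s \<ge> T \<Longrightarrow> g s = 0) \<Longrightarrow> s \<ge> T \<Longrightarrow> forward_avg R g s = 0"
  by (simp add: forward_avg_def)

lemma forward_avg_eq_1: "(\<And>s. s < T + R \<Longrightarrow> g s = 1) \<Longrightarrow> R > 0 \<Longrightarrow> s < T \<Longrightarrow> forward_avg R g s = 1"
  by (simp add: forward_avg_def)

text \<open>
  A sharp cutoff averaged \<open>N\<close> times. Each average shortens the plateau by at most \<open>R\<close>; starting from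
  \<open>(N + 1) R\<close> therefore leaves the value 1 below \<open>R\<close>.
\<close>

definition cutoff :: "nat \<Rightarrow> nat \<Rightarrow> nat \<Rightarrow> real" where
  "cutoff N R = (forward_avg R ^^ N) (\<lambda>s. if s < Suc N * R then 1 else 0)"

lemma cutoff_aux:
  fixes N :: nat
  assumes R: "R > 0"
  defines "c k \<equiv> (forward_avg R ^^ k) (\<lambda>s. if s < Suc N * R then 1 else 0)"
  shows "k \<le> N \<Longrightarrow> s < (Suc N - k) * R \<Longrightarrow> c k s = 1"
    and "Suc N * R \<le> s \<Longrightarrow> c k s = 0"
    and "l \<le> k \<Longrightarrow> \<bar>(ndiff ^^ l) (c k) s\<bar> \<le> (2 / real R) ^ l"
proof -
  have cSuc: "c (Suc k) = forward_avg R (c k)" for k by (simp add: c_def)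
  show "k \<le> N \<Longrightarrow> s < (Suc N - k) * R \<Longrightarrow> c k s = 1"
  proof (induction k arbitrary: s)
    case (Suc k)
    have "(Suc N - k) * R = (Suc N - Suc k) * R + R" using Suc.prems(1) by (simp add: Suc_diff_le)
    with Suc show ?case
      unfolding cSuc using R by (intro forward_avg_eq_1[where T = "(Suc N - Suc k) * R"]) auto
  qed (simp add: c_def)
  show "Suc N * R \<le> s \<Longrightarrow> c k s = 0"
    by (induction k arbitrary: s) (auto simp: cSuc intro: forward_avg_eq_0, simp add: c_def)
  show "l \<le> k \<Longrightarrow> \<bar>(ndiff ^^ l) (c k) s\<bar> \<le> (2 / real R) ^ l"
  proof (induction k arbitrary: l s)
    case (Suc k)
    then show ?case unfolding cSuc using R by (intro forward_avg_gain) auto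
  qed (simp add: c_def)
qed

lemma cutoff_eq_1: "R > 0 \<Longrightarrow> s < R \<Longrightarrow> cutoff N R s = 1"
  unfolding cutoff_def by (rule cutoff_aux(1)) auto

lemma cutoff_eq_0: "R > 0 \<Longrightarrow> Suc N * R \<le> s \<Longrightarrow> cutoff N R s = 0"
  unfolding cutoff_def by (rule cutoff_aux(2))

lemma cutoff_ndiff: "R > 0 \<Longrightarrow> l \<le> N \<Longrightarrow> \<bar>(ndiff ^^ l) (cutoff N R) s\<bar> \<le> (2 / real R) ^ l"
  unfolding cutoff_def by (rule cutoff_aux(3))

text \<open>
  Successive differences of the cutoffs at scales \<open>2\<^sup>j\<close>, so that the sum over \<open>j\<close> telescopes to 1. The piece
  \<open>j = 0\<close> keeps the lowest frequencies.
\<close>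

definition dyadic :: "nat \<Rightarrow> nat \<Rightarrow> nat \<Rightarrow> real" where
  "dyadic N j s = cutoff N (2 ^ j) s - (if j = 0 then 0 else cutoff N (2 ^ (j - 1)) s)"

lemma dyadic_eq_0_high: "Suc N * 2 ^ j \<le> s \<Longrightarrow> dyadic N j s = 0"
proof -
  assume s: "Suc N * 2 ^ j \<le> s"
  have "Suc N * 2 ^ (j - 1) \<le> Suc N * 2 ^ j" by (intro mult_le_mono2 power_increasing) auto
  from order_trans[OF this s] s show ?thesis
    by (simp add: dyadic_def cutoff_eq_0 del: mult_Suc One_nat_def)
qed

lemma dyadic_eq_0_low: "2 * Suc s \<le> 2 ^ j \<Longrightarrow> dyadic N j s = 0"
  by (cases j) (auto simp: dyadic_def cutoff_eq_1)

lemma dyadic_ndiff: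
  assumes "l \<le> N"
  shows "\<bar>(ndiff ^^ l) (dyadic N j) s\<bar> * (2 ^ j) ^ l \<le> 2 * 4 ^ N"
proof -
  define p where "p s = (if j = 0 then 0 else cutoff N (2 ^ (j - 1)) s)" for s
  have split: "(ndiff ^^ l) (dyadic N j) s = (ndiff ^^ l) (cutoff N (2 ^ j)) s - (ndiff ^^ l) p s"
    using ndiff_funpow_lincomb[of l "cutoff N (2 ^ j)" 0 p 0 1 s] by (simp add: dyadic_def[abs_def] p_def[symmetric])
  have z: "(ndiff ^^ l) (\<lambda>s. 0) s = 0"
    using ndiff_funpow_lincomb[of l "\<lambda>_. 0" 0 "\<lambda>_. 0" 0 1 s] by simp
  have le: "(4::real) ^ l \<le> 4 ^ N" "(2::real) ^ l \<le> 4 ^ N"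
    using assms by (auto intro!: power_increasing order_trans[OF power_mono[of 2 "4::real" l]])
  have 1: "\<bar>(ndiff ^^ l) (cutoff N (2 ^ j)) s\<bar> * (2 ^ j) ^ l \<le> 4 ^ N"
  proof -
    have "\<bar>(ndiff ^^ l) (cutoff N (2 ^ j)) s\<bar> * (2 ^ j) ^ l \<le> (2 / real (2 ^ j)) ^ l * (2 ^ j) ^ l"
      by (intro mult_right_mono cutoff_ndiff assms) auto
    also have "\<dots> = 2 ^ l" by (simp add: power_divide)
    finally show ?thesis using le by simp
  qed
  have 2: "\<bar>(ndiff ^^ l) p s\<bar> * (2 ^ j) ^ l \<le> 4 ^ N"
  proof (cases j)
    case 0
    then show ?thesis using z by (simp add: p_def[abs_def])
  next
    case (Suc q)
    have "\<bar>(ndiff ^^ l) (cutoff N (2 ^ q)) s\<bar> * (2 ^ j) ^ l \<le> (2 / real (2 ^ q)) ^ l * (2 ^ j) ^ l"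
      by (intro mult_right_mono cutoff_ndiff assms) auto
    also have "\<dots> = (2 / 2 ^ q * 2 ^ j) ^ l" by (simp only: power_mult_distrib of_nat_power of_nat_numeral)
    also have "\<dots> = 4 ^ l" by (simp add: Suc)
    also have "\<dots> \<le> 4 ^ N" by (rule le)
    finally show ?thesis by (simp add: Suc p_def[abs_def])
  qed
  have "\<bar>(ndiff ^^ l) (dyadic N j) s\<bar> * (2 ^ j) ^ l
     \<le> (\<bar>(ndiff ^^ l) (cutoff N (2 ^ j)) s\<bar> + \<bar>(ndiff ^^ l) p s\<bar>) * (2 ^ j) ^ l"
    unfolding split by (intro mult_right_mono abs_triangle_ineq4) simp
  then show ?thesis using 1 2 by (simp add: distrib_right)
qed

lemma dyadic_sums: "(\<lambda>j. dyadic N j s) sums 1"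
proof -
  have part: "(\<Sum>j<Suc J. dyadic N j s) = cutoff N (2 ^ J) s" for J
    by (induction J) (simp_all add: dyadic_def)
  have "\<forall>\<^sub>F J in sequentially. (\<Sum>j<Suc J. dyadic N j s) = 1"
    using eventually_ge_at_top[of s]
  proof eventually_elim
    case (elim J)
    have "s < 2 ^ J" using elim less_exp[of J] by linarith
    then show ?case unfolding part by (intro cutoff_eq_1) auto
  qed
  then have "(\<lambda>J. \<Sum>j<Suc J. dyadic N j s) \<longlonglongrightarrow> 1"
    by (rule tendsto_eventually)
  then show ?thesis
    unfolding sums_def by (rule LIMSEQ_imp_Suc)
qed

section \<open>Differences of products\<close>

lemma fdiff_funpow_add: "(fdiff i ^^ l) (\<lambda>\<xi>. u \<xi> + v \<xi>) \<xi> = (fdiff i ^^ l) u \<xi> + (fdiff i ^^ l) v \<xi>"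
  by (induction l arbitrary: \<xi>) (simp_all add: fdiff_def)

lemma fdiff_funpow_shift: "(fdiff i ^^ l) (\<lambda>\<xi>. v (\<xi> + \<zeta>)) \<xi> = (fdiff i ^^ l) v (\<xi> + \<zeta>)"
  by (induction l arbitrary: \<xi>) (simp_all add: fdiff_def ac_simps)

lemma fdiff_funpow_radial:
  "(fdiff i ^^ l) (\<lambda>\<xi>. complex_of_real (\<phi> (mi_abs \<xi>))) \<xi> = complex_of_real ((ndiff ^^ l) \<phi> (mi_abs \<xi>))"
  by (induction l arbitrary: \<xi>) (simp_all add: fdiff_def ndiff_def mi_abs_add mi_abs_axis)

lemma fdiff_funpow_eq_0:
  "(\<And>\<eta>. mi_abs \<eta> \<le> mi_abs \<xi> + l \<Longrightarrow> g \<eta> = 0) \<Longrightarrow> (fdiff i ^^ l) g \<xi> = 0"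
proof (induction l arbitrary: \<xi>)
  case (Suc l)
  have "(fdiff i ^^ l) g (\<xi> + axis i 1) = 0" "(fdiff i ^^ l) g \<xi> = 0"
    by (rule Suc.IH; rule Suc.prems; simp add: mi_abs_add mi_abs_axis)+
  then show ?case by (simp add: fdiff_def[of i "(fdiff i ^^ l) g"])
qed simp

text \<open>
  The Leibniz rule \<open>\<triangle>(u v) = \<triangle>u v(\<cdot> + e) + u \<triangle>v\<close> is iterated on the bounds themselves. It evaluates \<open>v\<close> at
  shifted points but \<open>u\<close> only at \<open>\<xi>\<close>, which is why the hypothesis on \<open>u\<close> is local.
\<close>

lemma fdiff_funpow_mult_bound:
  assumes \<rho>: "\<rho> > 0" and "U \<ge> 0" "V \<ge> 0"
    and "\<And>q. q \<le> l \<Longrightarrow> cmod ((fdiff i ^^ q) u \<xi>) * \<rho> ^ q \<le> U"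
    and "\<And>q \<eta>. q \<le> l \<Longrightarrow> cmod ((fdiff i ^^ q) v \<eta>) * \<rho> ^ q \<le> V"
  shows "cmod ((fdiff i ^^ l) (\<lambda>\<eta>. u \<eta> * v \<eta>) \<xi>) * \<rho> ^ l \<le> 2 ^ l * U * V"
  using assms(2-)
proof (induction l arbitrary: u v U V)
  case 0
  then show ?case
    using 0(3)[of 0] 0(4)[of 0 \<xi>] by (simp add: norm_mult mult_mono)
next
  case (Suc l)
  have eq: "fdiff i (\<lambda>\<eta>. u \<eta> * v \<eta>) = (\<lambda>\<eta>. fdiff i u \<eta> * v (\<eta> + axis i 1) + u \<eta> * fdiff i v \<eta>)"
    by (simp add: fdiff_def fun_eq_iff algebra_simps)
  have pow: "(fdiff i ^^ q) (fdiff i w) = (fdiff i ^^ Suc q) w" for q w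
    by (simp add: funpow_Suc_right del: funpow.simps)
  have 1: "cmod ((fdiff i ^^ l) (\<lambda>\<eta>. fdiff i u \<eta> * v (\<eta> + axis i 1)) \<xi>) * \<rho> ^ l \<le> 2 ^ l * (U / \<rho>) * V"
  proof (rule Suc.IH)
    show "cmod ((fdiff i ^^ q) (fdiff i u) \<xi>) * \<rho> ^ q \<le> U / \<rho>" if "q \<le> l" for q
      using Suc.prems(3)[of "Suc q"] that \<rho> by (simp add: pow field_simps del: funpow.simps)
    show "cmod ((fdiff i ^^ q) (\<lambda>\<eta>. v (\<eta> + axis i 1)) \<eta>) * \<rho> ^ q \<le> V" if "q \<le> l" for q \<eta>
      using Suc.prems(4)[of q "\<eta> + axis i 1"] that by (simp add: fdiff_funpow_shift)
  qed (use Suc.prems \<rho> in auto)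
  have 2: "cmod ((fdiff i ^^ l) (\<lambda>\<eta>. u \<eta> * fdiff i v \<eta>) \<xi>) * \<rho> ^ l \<le> 2 ^ l * U * (V / \<rho>)"
  proof (rule Suc.IH)
    show "cmod ((fdiff i ^^ q) (fdiff i v) \<eta>) * \<rho> ^ q \<le> V / \<rho>" if "q \<le> l" for q \<eta>
      using Suc.prems(4)[of "Suc q" \<eta>] that \<rho> by (simp add: pow field_simps del: funpow.simps)
  qed (use Suc.prems \<rho> in auto)
  have "cmod ((fdiff i ^^ Suc l) (\<lambda>\<eta>. u \<eta> * v \<eta>) \<xi>) * \<rho> ^ Suc l
    = cmod ((fdiff i ^^ l) (\<lambda>\<eta>. fdiff i u \<eta> * v (\<eta> + axis i 1)) \<xi> + (fdiff i ^^ l) (\<lambda>\<eta>. u \<eta> * fdiff i v \<eta>) \<xi>) * \<rho> ^ l * \<rho>"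
    unfolding pow[symmetric] eq fdiff_funpow_add by simp
  also have "\<dots> \<le> (cmod ((fdiff i ^^ l) (\<lambda>\<eta>. fdiff i u \<eta> * v (\<eta> + axis i 1)) \<xi>)
       + cmod ((fdiff i ^^ l) (\<lambda>\<eta>. u \<eta> * fdiff i v \<eta>) \<xi>)) * \<rho> ^ l * \<rho>"
    using \<rho> by (intro mult_right_mono norm_triangle_ineq) auto
  also have "\<dots> \<le> (2 ^ l * (U / \<rho>) * V + 2 ^ l * U * (V / \<rho>)) * \<rho>"
    unfolding distrib_right[of _ _ "\<rho> ^ l"] using \<rho> by (intro mult_right_mono add_mono 1 2) auto
  also have "\<dots> = 2 ^ Suc l * U * V"
    using \<rho> by (simp add: field_simps)
  finally show ?case .
qed

text \<open>
  Differences of the localized symbol vanish at \<open>\<xi>\<close> unless \<open>2\<^sup>j\<close> is at most \<open>D\<close> times the bracket of \<open>\<xi>\<close>. In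
  that range each power of \<open>2\<^sup>j\<close> is absorbed by the decay of the corresponding difference of \<open>\<tau>\<close>, and
  the remaining negative power of the bracket is at most a multiple of \<open>2\<^sup>j powr (m / 2)\<close>.
\<close>

lemma dyadic_symbol_bound:
  fixes \<tau> :: "nat ^ 'n \<Rightarrow> complex"
  assumes m: "m < 0" and C: "C \<ge> 0"
    and \<tau>: "\<And>l \<xi>. l \<le> N \<Longrightarrow> cmod ((fdiff i ^^ l) \<tau> \<xi>) \<le> C * mi_bracket \<xi> powr (m / 2 - real l)"
    and l: "l \<le> N"
  defines "D \<equiv> 2 * real (Suc N)"
  shows "cmod ((fdiff i ^^ l) (\<lambda>\<xi>. \<tau> \<xi> * complex_of_real (dyadic N j (mi_abs \<xi>))) \<xi>) * (2 ^ j) ^ l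
     \<le> 2 ^ N * (C * D powr (- m / 2) * D ^ N) * (2 * 4 ^ N) * (2 powr (m / 2)) ^ j"
proof (cases "2 * Suc (mi_abs \<xi> + l) \<le> 2 ^ j")
  case True
  have "(fdiff i ^^ l) (\<lambda>\<xi>. \<tau> \<xi> * complex_of_real (dyadic N j (mi_abs \<xi>))) \<xi> = 0"
  proof (rule fdiff_funpow_eq_0)
    fix \<eta> :: "nat ^ 'n" assume "mi_abs \<eta> \<le> mi_abs \<xi> + l"
    then have "2 * Suc (mi_abs \<eta>) \<le> 2 ^ j" by (intro order_trans[OF _ True]) simp
    then show "\<tau> \<eta> * complex_of_real (dyadic N j (mi_abs \<eta>)) = 0" by (simp add: dyadic_eq_0_low)
  qed
  then show ?thesis using C by (simp add: D_def)
next
  case False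
  let ?b = "mi_bracket \<xi>" and ?R = "2 ^ j :: real"
  have b1: "?b \<ge> 1" by (simp add: mi_bracket_def)
  have D1: "D \<ge> 1" by (simp add: D_def)
  have Rb: "?R \<le> D * ?b"
  proof -
    have "2 ^ j \<le> 2 * Suc (mi_abs \<xi> + l)" using False by simp
    also have "\<dots> \<le> 2 * (Suc N * Suc (mi_abs \<xi>))" using l by simp
    finally have "real (2 ^ j) \<le> real (2 * (Suc N * Suc (mi_abs \<xi>)))" by (rule of_nat_mono)
    then show ?thesis by (simp add: D_def mi_bracket_def algebra_simps)
  qed
  have U: "cmod ((fdiff i ^^ q) \<tau> \<xi>) * ?R ^ q \<le> C * D powr (- m / 2) * D ^ N * (2 powr (m / 2)) ^ j"
    if "q \<le> l" for q
  proof -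
    have "cmod ((fdiff i ^^ q) \<tau> \<xi>) * ?R ^ q \<le> C * ?b powr (m / 2 - real q) * (D * ?b) ^ q"
      using \<tau>[of q \<xi>] that l C Rb by (intro mult_mono power_mono) auto
    also have "\<dots> = C * ?b powr (m / 2) * D ^ q"
      using b1 by (simp add: powr_diff powr_realpow power_mult_distrib)
    also have "\<dots> \<le> C * (?R / D) powr (m / 2) * D ^ N"
    proof (intro mult_mono mult_left_mono power_increasing D1)
      show "?b powr (m / 2) \<le> (?R / D) powr (m / 2)"
        using m D1 Rb by (intro powr_mono2') (auto simp: field_simps)
    qed (use that l C D1 in auto)
    also have "(?R / D) powr (m / 2) = D powr (- m / 2) * (2 powr (m / 2)) ^ j"
    proof -
      have "?R powr (m / 2) = (2 powr (m / 2)) ^ j"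
        by (simp add: powr_realpow[symmetric] powr_powr mult.commute)
      then show ?thesis using D1 by (simp add: powr_divide powr_minus field_simps)
    qed
    finally show ?thesis by (simp only: mult_ac)
  qed
  have V: "cmod ((fdiff i ^^ q) (\<lambda>\<xi>. complex_of_real (dyadic N j (mi_abs \<xi>))) \<eta>) * ?R ^ q \<le> 2 * 4 ^ N" if "q \<le> l" for q \<eta>
    unfolding fdiff_funpow_radial using dyadic_ndiff[of q N j "mi_abs \<eta>"] that l by simp
  have "cmod ((fdiff i ^^ l) (\<lambda>\<xi>. \<tau> \<xi> * complex_of_real (dyadic N j (mi_abs \<xi>))) \<xi>) * ?R ^ l
     \<le> 2 ^ l * (C * D powr (- m / 2) * D ^ N * (2 powr (m / 2)) ^ j) * (2 * 4 ^ N)"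
    using C D1 by (intro fdiff_funpow_mult_bound U V) auto
  also have "\<dots> \<le> 2 ^ N * (C * D powr (- m / 2) * D ^ N * (2 powr (m / 2)) ^ j) * (2 * 4 ^ N)"
    using C D1 l by (intro mult_right_mono power_increasing) auto
  finally show ?thesis by (simp only: mult_ac)
qed

section \<open>Summing the pieces\<close>

text \<open>
  Cauchy-Schwarz with the weights \<open>r\<^sup>j\<close>: geometric decay in \<open>L2\<close> leaves room for a weighted square sum.
\<close>

lemma series_square_bound:
  fixes t :: "nat \<Rightarrow> complex"
  assumes r: "0 < r" "r < 1" and s: "summable (\<lambda>j. (cmod (t j))\<^sup>2 / r ^ j)"
  shows "summable t" and "(cmod (\<Sum>j. t j))\<^sup>2 \<le> (\<Sum>j. (cmod (t j))\<^sup>2 / r ^ j) / (1 - r)"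
proof -
  have geo: "summable (\<lambda>j. r ^ j)" "(\<Sum>j. r ^ j) = 1 / (1 - r)"
    using r by (auto intro: summable_geometric suminf_geometric)
  show sum: "summable t"
  proof (rule summable_comparison_test')
    show "summable (\<lambda>j. r ^ j + (cmod (t j))\<^sup>2 / r ^ j)"
      by (intro summable_add geo s)
    fix j assume "j \<ge> (0::nat)"
    have "2 * cmod (t j) = 2 * sqrt (r ^ j) * (cmod (t j) / sqrt (r ^ j))" using r by simp
    also have "\<dots> \<le> (sqrt (r ^ j))\<^sup>2 + (cmod (t j) / sqrt (r ^ j))\<^sup>2" by (rule sum_squares_bound)
    also have "\<dots> = r ^ j + (cmod (t j))\<^sup>2 / r ^ j" using r by (simp add: power_divide)
    finally show "norm (t j) \<le> r ^ j + (cmod (t j))\<^sup>2 / r ^ j"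
      using norm_ge_zero[of "t j"] by linarith
  qed
  have part: "(cmod (\<Sum>j<J. t j))\<^sup>2 \<le> (\<Sum>j. (cmod (t j))\<^sup>2 / r ^ j) / (1 - r)" for J
  proof -
    have "(cmod (\<Sum>j<J. t j))\<^sup>2 \<le> (\<Sum>j<J. cmod (t j))\<^sup>2"
      by (intro power_mono norm_sum) simp
    also have "\<dots> = (\<Sum>j<J. sqrt (r ^ j) * (cmod (t j) / sqrt (r ^ j)))\<^sup>2"
      using r by simp
    also have "\<dots> \<le> (\<Sum>j<J. (sqrt (r ^ j))\<^sup>2) * (\<Sum>j<J. (cmod (t j) / sqrt (r ^ j))\<^sup>2)"
      by (rule Cauchy_Schwarz_ineq_sum)
    also have "\<dots> = (\<Sum>j<J. r ^ j) * (\<Sum>j<J. (cmod (t j))\<^sup>2 / r ^ j)"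
      using r by (simp add: power_divide)
    also have "\<dots> \<le> (\<Sum>j. r ^ j) * (\<Sum>j. (cmod (t j))\<^sup>2 / r ^ j)"
      using r geo s by (intro mult_mono sum_le_suminf sum_nonneg suminf_nonneg) auto
    finally show ?thesis by (simp add: geo)
  qed
  have "(\<lambda>J. (cmod (\<Sum>j<J. t j))\<^sup>2) \<longlonglongrightarrow> (cmod (\<Sum>j. t j))\<^sup>2"
    by (intro tendsto_power tendsto_norm summable_LIMSEQ sum)
  then show "(cmod (\<Sum>j. t j))\<^sup>2 \<le> (\<Sum>j. (cmod (t j))\<^sup>2 / r ^ j) / (1 - r)"
    by (rule LIMSEQ_le_const2) (use part in auto)
qed

text \<open>
  Completeness of \<open>L2\<close> in the form needed here: the weighted square sum of a geometrically decaying series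
  has finite integral, hence is finite almost everywhere, and the series converges there pointwise.
\<close>

lemma L2_series:
  fixes t :: "nat \<Rightarrow> 'a \<Rightarrow> complex"
  assumes [measurable]: "\<And>j. t j \<in> borel_measurable M" and r: "0 < r" "r < 1" and B: "B \<ge> 0"
    and bd: "\<And>j. (\<integral>\<^sup>+x. ennreal ((cmod (t j x))\<^sup>2) \<partial>M) \<le> ennreal (B * (r ^ j)\<^sup>2)"
  shows "AE x in M. summable (\<lambda>j. t j x)"
    and "(\<integral>\<^sup>+x. ennreal ((cmod (\<Sum>j. t j x))\<^sup>2) \<partial>M) \<le> ennreal (B / (1 - r)\<^sup>2)"
proof -
  define G where "G x = (\<Sum>j. ennreal ((cmod (t j x))\<^sup>2 / r ^ j))" for x
  have [measurable]: "G \<in> borel_measurable M" unfolding G_def by measurable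
  have geo: "summable (\<lambda>j. r ^ j)" "(\<Sum>j. r ^ j) = 1 / (1 - r)"
    using r by (auto intro: summable_geometric suminf_geometric)
  have "(\<integral>\<^sup>+x. G x \<partial>M) = (\<Sum>j. \<integral>\<^sup>+x. ennreal ((cmod (t j x))\<^sup>2 / r ^ j) \<partial>M)"
    unfolding G_def by (rule nn_integral_suminf) measurable
  also have "\<dots> \<le> (\<Sum>j. ennreal (B * r ^ j))"
  proof (intro suminf_le summableI)
    fix j
    have "(\<integral>\<^sup>+x. ennreal ((cmod (t j x))\<^sup>2 / r ^ j) \<partial>M) = (\<integral>\<^sup>+x. ennreal (1 / r ^ j) * ennreal ((cmod (t j x))\<^sup>2) \<partial>M)"
      using r by (intro nn_integral_cong) (simp flip: ennreal_mult)
    also have "\<dots> = ennreal (1 / r ^ j) * (\<integral>\<^sup>+x. ennreal ((cmod (t j x))\<^sup>2) \<partial>M)"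
      by (rule nn_integral_cmult) measurable
    also have "\<dots> \<le> ennreal (1 / r ^ j) * ennreal (B * (r ^ j)\<^sup>2)"
      by (intro mult_left_mono bd) simp
    also have "\<dots> = ennreal (B * r ^ j)"
      using r B by (subst ennreal_mult[symmetric]) (auto simp: power2_eq_square)
    finally show "(\<integral>\<^sup>+x. ennreal ((cmod (t j x))\<^sup>2 / r ^ j) \<partial>M) \<le> ennreal (B * r ^ j)" .
  qed
  also have "\<dots> = ennreal (B / (1 - r))"
    using r B geo by (subst suminf_ennreal2) (auto intro: summable_mult simp: suminf_mult)
  finally have Gint: "(\<integral>\<^sup>+x. G x \<partial>M) \<le> ennreal (B / (1 - r))" .
  then have "(\<integral>\<^sup>+x. G x \<partial>M) \<noteq> \<infinity>"
    using le_less_trans[OF _ ennreal_less_top] by (auto simp: top_unique)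
  then have fin: "AE x in M. G x \<noteq> \<infinity>"
    by (intro nn_integral_PInf_AE) auto
  have conv: "summable (\<lambda>j. (cmod (t j x))\<^sup>2 / r ^ j)" if "G x \<noteq> \<infinity>" for x
    using that r unfolding G_def by (intro summable_suminf_not_top) auto
  show "AE x in M. summable (\<lambda>j. t j x)"
    using fin by eventually_elim (intro series_square_bound(1)[OF r] conv)
  have "AE x in M. ennreal ((cmod (\<Sum>j. t j x))\<^sup>2) \<le> ennreal (1 / (1 - r)) * G x"
    using fin
  proof eventually_elim
    case (elim x)
    have s: "summable (\<lambda>j. (cmod (t j x))\<^sup>2 / r ^ j)" by (rule conv[OF elim])
    have "ennreal ((cmod (\<Sum>j. t j x))\<^sup>2) \<le> ennreal ((\<Sum>j. (cmod (t j x))\<^sup>2 / r ^ j) / (1 - r))"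
      by (intro ennreal_leI series_square_bound(2)[OF r] s)
    also have "\<dots> = ennreal (1 / (1 - r)) * ennreal (\<Sum>j. (cmod (t j x))\<^sup>2 / r ^ j)"
      using r s by (subst ennreal_mult[symmetric]) (auto intro!: suminf_nonneg)
    also have "ennreal (\<Sum>j. (cmod (t j x))\<^sup>2 / r ^ j) = G x"
      unfolding G_def using r s by (intro suminf_ennreal2[symmetric]) auto
    finally show ?case .
  qed
  then have "(\<integral>\<^sup>+x. ennreal ((cmod (\<Sum>j. t j x))\<^sup>2) \<partial>M) \<le> (\<integral>\<^sup>+x. ennreal (1 / (1 - r)) * G x \<partial>M)"
    by (rule nn_integral_mono_AE)
  also have "\<dots> = ennreal (1 / (1 - r)) * (\<integral>\<^sup>+x. G x \<partial>M)"
    by (rule nn_integral_cmult) measurable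
  also have "\<dots> \<le> ennreal (1 / (1 - r)) * ennreal (B / (1 - r))"
    by (intro mult_left_mono Gint) simp
  also have "\<dots> = ennreal (B / (1 - r)\<^sup>2)"
    using r B by (subst ennreal_mult[symmetric]) (auto simp: power2_eq_square)
  finally show "(\<integral>\<^sup>+x. ennreal ((cmod (\<Sum>j. t j x))\<^sup>2) \<partial>M) \<le> ennreal (B / (1 - r)\<^sup>2)" .
qed

section \<open>Hermite coefficients\<close>

lemma hermite_fun_measurable_lebesgue [measurable]:
  "(hermite_fun \<xi> :: real ^ 'n \<Rightarrow> real) \<in> borel_measurable lebesgue"
  by (rule measurable_completion) simp

lemma hermite_fun_orthonormal_lebesgue:
  "has_bochner_integral lebesgue (\<lambda>x :: real ^ 'n. hermite_fun \<xi> x * hermite_fun \<eta> x) (if \<xi> = \<eta> then 1 else 0)"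
  using hermite_fun_orthonormal[of \<xi> \<eta>]
  unfolding has_bochner_integral_iff by (subst integrable_completion integral_completion; simp)+

lemma integrable_L2_hermite_fun:
  "f \<in> L2 \<Longrightarrow> integrable lebesgue (\<lambda>x. f x * complex_of_real (hermite_fun \<xi> x))"
  using hermite_fun_orthonormal_lebesgue[of \<xi> \<xi>]
  by (intro integrable_mult_of_square_integrable) (auto simp: L2_def has_bochner_integral_iff)

lemma hermite_coeff_add:
  "f \<in> L2 \<Longrightarrow> g \<in> L2 \<Longrightarrow> hermite_coeff (\<lambda>y. f y + g y) \<xi> = hermite_coeff f \<xi> + hermite_coeff g \<xi>"
  by (simp add: hermite_coeff_def distrib_right integrable_L2_hermite_fun)

lemma hermite_coeff_cmult: "hermite_coeff (\<lambda>y. c * f y) \<xi> = c * hermite_coeff f \<xi>"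
  by (simp add: hermite_coeff_def mult.assoc)

lemma hermite_coeff_span:
  assumes "finite A"
  shows "hermite_coeff (\<lambda>x. \<Sum>\<eta>\<in>A. c \<eta> * complex_of_real (hermite_fun \<eta> x)) \<xi> = (if \<xi> \<in> A then c \<xi> else 0)"
proof -
  have "has_bochner_integral lebesgue (\<lambda>x. \<Sum>\<eta>\<in>A. c \<eta> * complex_of_real (hermite_fun \<eta> x * hermite_fun \<xi> x))
     (\<Sum>\<eta>\<in>A. c \<eta> * complex_of_real (if \<eta> = \<xi> then 1 else 0))"
    by (intro has_bochner_integral_sum has_bochner_integral_mult_right has_bochner_integral_of_real
        hermite_fun_orthonormal_lebesgue)
  also have "(\<lambda>x. \<Sum>\<eta>\<in>A. c \<eta> * complex_of_real (hermite_fun \<eta> x * hermite_fun \<xi> x))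
    = (\<lambda>x. (\<Sum>\<eta>\<in>A. c \<eta> * complex_of_real (hermite_fun \<eta> x)) * complex_of_real (hermite_fun \<xi> x))"
    by (simp add: sum_distrib_right mult.assoc)
  also have "(\<Sum>\<eta>\<in>A. c \<eta> * complex_of_real (if \<eta> = \<xi> then 1 else 0)) = (if \<xi> \<in> A then c \<xi> else 0)"
    using assms by (simp add: if_distrib cong: if_cong)
  finally show ?thesis
    unfolding hermite_coeff_def by (rule has_bochner_integral_integral_eq)
qed

section \<open>The symbol hypothesis\<close>

lemma mfdiff_axis: "mfdiff (axis i l) g = (fdiff i ^^ l) g"
proof -
  interpret comp_fun_commute "\<lambda>j. fdiff j ^^ ((axis i l) $ j)"
    by (rule comp_fun_commute_fdiff)
  have "Finite_Set.fold (\<lambda>j. fdiff j ^^ ((axis i l) $ j)) g (insert i (UNIV - {i}))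
     = (fdiff i ^^ ((axis i l) $ i)) (Finite_Set.fold (\<lambda>j. fdiff j ^^ ((axis i l) $ j)) g (UNIV - {i}))"
    by (rule fold_insert) auto
  also have "Finite_Set.fold (\<lambda>j. fdiff j ^^ ((axis i l) $ j)) g A = g" if "finite A" "i \<notin> A" for A
    using that
  proof (induction A)
    case (insert k A)
    then show ?case by (subst fold_insert) (auto simp: axis_def)
  qed simp
  then have "Finite_Set.fold (\<lambda>j. fdiff j ^^ ((axis i l) $ j)) g (UNIV - {i}) = g"
    by simp
  finally show ?thesis
    by (simp add: mfdiff_def insert_absorb)
qed

text \<open>
  Only differences in a single direction enter the kernel estimates. There are countably many
  inequalities, so one null set serves for all of them, and finitely many constants, so their sum bounds
  them uniformly.
\<close>

lemma AE_symbol_bound: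
  fixes \<sigma> :: "real ^ 'n \<Rightarrow> nat ^ 'n \<Rightarrow> complex"
  assumes "\<And>\<kappa> :: nat ^ 'n. mi_abs \<kappa> \<le> N \<Longrightarrow>
           \<exists>C::real. \<forall>\<xi>. Linf_norm (\<lambda>x. mfdiff \<kappa> (\<sigma> x) \<xi>)
             \<le> ereal (C * mi_bracket \<xi> powr (m / 2 - real (mi_abs \<kappa>)))"
  obtains C where "C \<ge> 0" "AE x in lebesgue. \<forall>i \<xi>. \<forall>l\<le>N.
      cmod ((fdiff i ^^ l) (\<sigma> x) \<xi>) \<le> C * mi_bracket \<xi> powr (m / 2 - real l)"
proof -
  have "\<forall>i l. \<exists>c. l \<le> N \<longrightarrow> (\<forall>\<xi>. Linf_norm (\<lambda>x. (fdiff i ^^ l) (\<sigma> x) \<xi>) \<le> ereal (c * mi_bracket \<xi> powr (m / 2 - real l)))"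
    using assms[of "axis i l" for i l] by (simp add: mi_abs_axis mfdiff_axis)
  then obtain c where c: "\<And>i l \<xi>. l \<le> N \<Longrightarrow>
      Linf_norm (\<lambda>x. (fdiff i ^^ l) (\<sigma> x) \<xi>) \<le> ereal (c i l * mi_bracket \<xi> powr (m / 2 - real l))"
    by metis
  define C where "C = (\<Sum>p\<in>UNIV \<times> {..N}. \<bar>c (fst p) (snd p)\<bar>)"
  have cC: "c i l \<le> C" if "l \<le> N" for i l
  proof -
    have "\<bar>c (fst (i, l)) (snd (i, l))\<bar> \<le> C"
      unfolding C_def using that by (intro member_le_sum) auto
    then show ?thesis by simp
  qed
  have "AE x in lebesgue. l \<le> N \<longrightarrow> cmod ((fdiff i ^^ l) (\<sigma> x) \<xi>) \<le> C * mi_bracket \<xi> powr (m / 2 - real l)" for i l \<xi>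
  proof (cases "l \<le> N")
    case True
    have "AE x in lebesgue. ereal (cmod ((fdiff i ^^ l) (\<sigma> x) \<xi>)) \<le> Linf_norm (\<lambda>x. (fdiff i ^^ l) (\<sigma> x) \<xi>)"
      unfolding Linf_norm_def by (rule esssup_AE)
    then show ?thesis
    proof eventually_elim
      case (elim x)
      from order_trans[OF elim c[OF True]]
      have "cmod ((fdiff i ^^ l) (\<sigma> x) \<xi>) \<le> c i l * mi_bracket \<xi> powr (m / 2 - real l)" by simp
      also have "\<dots> \<le> C * mi_bracket \<xi> powr (m / 2 - real l)"
        by (intro mult_right_mono cC True) simp
      finally show ?case by simp
    qed
  qed simp
  then have "AE x in lebesgue. \<forall>i l \<xi>. l \<le> N \<longrightarrow> cmod ((fdiff i ^^ l) (\<sigma> x) \<xi>) \<le> C * mi_bracket \<xi> powr (m / 2 - real l)"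
    by (simp add: AE_all_countable)
  then have "AE x in lebesgue. \<forall>i \<xi>. \<forall>l\<le>N. cmod ((fdiff i ^^ l) (\<sigma> x) \<xi>) \<le> C * mi_bracket \<xi> powr (m / 2 - real l)"
    by (rule eventually_mono) blast
  moreover have "C \<ge> 0" unfolding C_def by (intro sum_nonneg) simp
  ultimately show thesis by (rule that[rotated])
qed

section \<open>Boundedness\<close>

text \<open>
  The sum is finite, so the piece is defined on all of \<open>L2\<close>; the index set is large enough to contain
  the support of the cutoff together with \<open>N\<close> further shifts.
\<close>

definition dyadic_piece ::
    "(real ^ 'n \<Rightarrow> nat ^ 'n \<Rightarrow> complex) \<Rightarrow> nat \<Rightarrow> nat \<Rightarrow> (real ^ 'n \<Rightarrow> complex) \<Rightarrow> real ^ 'n \<Rightarrow> complex" where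
  "dyadic_piece \<sigma> N j f x = (\<Sum>\<xi>\<in>mi_ball ((2 * N + 1) * 2 ^ j).
     (\<sigma> x \<xi> * complex_of_real (dyadic N j (mi_abs \<xi>))) * hermite_coeff f \<xi> * complex_of_real (hermite_fun \<xi> x))"

lemma dyadic_supp:
  assumes "dyadic N j s \<noteq> 0"
  shows "s + N \<le> (2 * N + 1) * 2 ^ j"
proof -
  have "s < Suc N * 2 ^ j"
    using assms dyadic_eq_0_high[of N j s] by (meson not_less)
  moreover have "N * 1 \<le> N * 2 ^ j" by (intro mult_le_mono2) simp
  moreover have "(2 * N + 1) * 2 ^ j = Suc N * 2 ^ j + N * 2 ^ j" by (simp add: algebra_simps)
  ultimately show ?thesis by linarith
qed

lemma dyadic_piece_bound:
  fixes \<sigma> :: "real ^ 'n \<Rightarrow> nat ^ 'n \<Rightarrow> complex"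
  assumes m: "m < 0" and N: "CARD('n) + 1 \<le> 2 * N" and C: "C \<ge> 0"
    and \<sigma>: "AE x in lebesgue. \<forall>i \<xi>. \<forall>l\<le>N. cmod ((fdiff i ^^ l) (\<sigma> x) \<xi>) \<le> C * mi_bracket \<xi> powr (m / 2 - real l)"
  obtains B where "B \<ge> 0"
    "\<And>f j. f \<in> L2 \<Longrightarrow> (\<integral>\<^sup>+x. ennreal ((cmod (dyadic_piece \<sigma> N j f x))\<^sup>2) \<partial>lebesgue)
        \<le> ennreal (B * (L2_norm f)\<^sup>2 * ((2 powr (m / 2)) ^ j)\<^sup>2)"
proof -
  define D where "D = 2 * real (Suc N)"
  define A where "A = (2 ^ N * (C * D powr (- m / 2) * D ^ N) * (2 * 4 ^ N)) * real (2 * N + 1) ^ N"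
  define P where "P = piece_const CARD('n) N * (4 + 4 * real CARD('n)) ^ CARD('n)"
  have P: "P \<ge> 0" using moment_const_nonneg[of N 0] by (simp add: P_def piece_const_def)
  have "(\<integral>\<^sup>+x. ennreal ((cmod (dyadic_piece \<sigma> N j f x))\<^sup>2) \<partial>lebesgue)
        \<le> ennreal ((P * A\<^sup>2) * (L2_norm f)\<^sup>2 * ((2 powr (m / 2)) ^ j)\<^sup>2)" if f: "f \<in> L2" for f j
  proof -
    let ?Q = "(2 * N + 1) * 2 ^ j"
    let ?M = "A * (2 powr (m / 2)) ^ j"
    have "(\<integral>\<^sup>+x. ennreal ((cmod (dyadic_piece \<sigma> N j f x))\<^sup>2) \<partial>lebesgue) \<le> ennreal (P * ?M\<^sup>2 * (L2_norm f)\<^sup>2)"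
      unfolding dyadic_piece_def P_def
    proof (rule pseudo_mult_piece_bound[OF _ N f])
      show "mi_abs \<xi> + N \<le> ?Q" if "\<sigma> x \<xi> * complex_of_real (dyadic N j (mi_abs \<xi>)) \<noteq> 0" for x \<xi>
        using that by (intro dyadic_supp) auto
      show "AE x in lebesgue. \<forall>i \<xi>. \<forall>l\<le>N. cmod ((fdiff i ^^ l) (\<lambda>\<xi>. \<sigma> x \<xi> * complex_of_real (dyadic N j (mi_abs \<xi>))) \<xi>) * real ?Q ^ l \<le> ?M"
        using \<sigma>
      proof (eventually_elim, intro allI impI)
        fix x i \<xi> l
        assume \<tau>: "\<forall>i \<xi>. \<forall>l\<le>N. cmod ((fdiff i ^^ l) (\<sigma> x) \<xi>) \<le> C * mi_bracket \<xi> powr (m / 2 - real l)" and l: "l \<le> N"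
        let ?d = "cmod ((fdiff i ^^ l) (\<lambda>\<xi>. \<sigma> x \<xi> * complex_of_real (dyadic N j (mi_abs \<xi>))) \<xi>)"
        have "?d * real ?Q ^ l = (?d * (2 ^ j) ^ l) * real (2 * N + 1) ^ l"
        proof -
          have "real ?Q = 2 ^ j * real (2 * N + 1)" by (simp add: algebra_simps)
          then show ?thesis by (simp only: power_mult_distrib mult.assoc)
        qed
        also have "\<dots> \<le> (2 ^ N * (C * D powr (- m / 2) * D ^ N) * (2 * 4 ^ N) * (2 powr (m / 2)) ^ j) * real (2 * N + 1) ^ N"
          unfolding D_def using \<tau> C l
          by (intro mult_mono dyadic_symbol_bound[OF m C] power_increasing) auto
        also have "\<dots> = ?M" by (simp only: A_def mult_ac)
        finally show "?d * real ?Q ^ l \<le> ?M" .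
      qed
    qed simp
    then show ?thesis by (simp only: power_mult_distrib mult_ac)
  qed
  moreover have "P * A\<^sup>2 \<ge> 0" using P by simp
  ultimately show thesis by (rule that[rotated])
qed

lemma dyadic_piece_measurable:
  assumes [measurable]: "\<And>\<xi>. (\<lambda>x. \<sigma> x \<xi>) \<in> borel_measurable lebesgue"
  shows "dyadic_piece \<sigma> N j f \<in> borel_measurable lebesgue"
  unfolding dyadic_piece_def by measurable

lemma dyadic_piece_add:
  "f \<in> L2 \<Longrightarrow> g \<in> L2 \<Longrightarrow> dyadic_piece \<sigma> N j (\<lambda>y. f y + g y) x = dyadic_piece \<sigma> N j f x + dyadic_piece \<sigma> N j g x"
  by (simp add: dyadic_piece_def hermite_coeff_add algebra_simps sum.distrib)

lemma dyadic_piece_cmult: "dyadic_piece \<sigma> N j (\<lambda>y. c * f y) x = c * dyadic_piece \<sigma> N j f x"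
  by (simp add: dyadic_piece_def hermite_coeff_cmult sum_distrib_left mult_ac)

lemma dyadic_piece_sums_on_span:
  assumes "f \<in> hermite_span"
  shows "(\<lambda>j. dyadic_piece \<sigma> N j f x) sums pseudo_mult \<sigma> f x"
proof -
  obtain A c where A: "finite A" and f: "f = (\<lambda>x. \<Sum>\<xi>\<in>A. c \<xi> * complex_of_real (hermite_fun \<xi> x))"
    using assms by (auto simp: hermite_span_def)
  define u where "u \<xi> = \<sigma> x \<xi> * hermite_coeff f \<xi> * complex_of_real (hermite_fun \<xi> x)" for \<xi>
  have u0: "u \<xi> = 0" if "\<xi> \<notin> A" for \<xi>
    using that by (simp add: u_def f hermite_coeff_span[OF A])
  have piece: "dyadic_piece \<sigma> N j f x = (\<Sum>\<xi>\<in>A. complex_of_real (dyadic N j (mi_abs \<xi>)) * u \<xi>)" for j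
  proof -
    let ?Q = "(2 * N + 1) * 2 ^ j"
    have "dyadic_piece \<sigma> N j f x = (\<Sum>\<xi>\<in>mi_ball ?Q. complex_of_real (dyadic N j (mi_abs \<xi>)) * u \<xi>)"
      unfolding dyadic_piece_def u_def by (intro sum.cong refl) (simp only: mult_ac)
    also have "\<dots> = (\<Sum>\<xi>\<in>mi_ball ?Q \<union> A. complex_of_real (dyadic N j (mi_abs \<xi>)) * u \<xi>)"
      using dyadic_supp[of N j "mi_abs _"] A
      by (intro sum.mono_neutral_left) (force simp: mi_ball_def[symmetric] finite_mi_ball, simp, force simp: mi_ball_def)
    also have "\<dots> = (\<Sum>\<xi>\<in>A. complex_of_real (dyadic N j (mi_abs \<xi>)) * u \<xi>)"
      using A u0 by (intro sum.mono_neutral_right) (auto simp: finite_mi_ball)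
    finally show ?thesis .
  qed
  have "(\<lambda>j. \<Sum>\<xi>\<in>A. complex_of_real (dyadic N j (mi_abs \<xi>)) * u \<xi>) sums (\<Sum>\<xi>\<in>A. complex_of_real 1 * u \<xi>)"
    by (intro sums_sum sums_mult2 sums_of_real dyadic_sums)
  moreover have "pseudo_mult \<sigma> f x = (\<Sum>\<xi>\<in>A. u \<xi>)"
  proof -
    have "pseudo_mult \<sigma> f x = (\<Sum>\<^sub>\<infinity>\<xi>\<in>A. u \<xi>)"
      unfolding pseudo_mult_def u_def[symmetric] by (rule infsum_cong_neutral) (use u0 in auto)
    then show ?thesis using A by simp
  qed
  ultimately show ?thesis by (simp add: piece)
qed

theorem theorem1p3:
  fixes \<sigma> :: "real ^ 'n \<Rightarrow> nat ^ 'n \<Rightarrow> complex" and m :: real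
  assumes "m < 0"
    and "\<And>\<xi>. (\<lambda>x. \<sigma> x \<xi>) \<in> borel_measurable lebesgue"
    and "\<And>\<kappa> :: nat ^ 'n. mi_abs \<kappa> \<le> CARD('n) div 2 + 1 \<Longrightarrow>
           \<exists>C::real. \<forall>\<xi>. Linf_norm (\<lambda>x. mfdiff \<kappa> (\<sigma> x) \<xi>)
             \<le> ereal (C * mi_bracket \<xi> powr (m / 2 - real (mi_abs \<kappa>)))"
  shows "extends_to_bounded_operator_L2 hermite_span (pseudo_mult \<sigma>)"
proof -
  define N where "N = CARD('n) div 2 + 1"
  define r where "r = (2::real) powr (m / 2)"
  \<comment> \<open>The pieces act on all of \<open>L2\<close>, so their sum is itself the extension.\<close>
  define T where "T f x = (\<Sum>j. dyadic_piece \<sigma> N j f x)" for f x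
  have r: "0 < r" "r < 1"
    using assms(1) by (auto simp: r_def powr_less_one)
  have N: "CARD('n) + 1 \<le> 2 * N" unfolding N_def by presburger
  note meas [measurable] = dyadic_piece_measurable[OF assms(2)]
  obtain C where C: "C \<ge> 0" and bound: "AE x in lebesgue. \<forall>i \<xi>. \<forall>l\<le>N.
      cmod ((fdiff i ^^ l) (\<sigma> x) \<xi>) \<le> C * mi_bracket \<xi> powr (m / 2 - real l)"
    using AE_symbol_bound[of N \<sigma> m] assms(3) unfolding N_def by blast
  obtain B where B: "B \<ge> 0" and piece: "\<And>f j. f \<in> L2 \<Longrightarrow>
      (\<integral>\<^sup>+x. ennreal ((cmod (dyadic_piece \<sigma> N j f x))\<^sup>2) \<partial>lebesgue) \<le> ennreal (B * (L2_norm f)\<^sup>2 * (r ^ j)\<^sup>2)"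
    using dyadic_piece_bound[OF assms(1) N C bound] unfolding r_def by metis
  have BB: "B * (L2_norm f)\<^sup>2 \<ge> 0" for f :: "real ^ 'n \<Rightarrow> complex" using B by simp
  have conv: "AE x in lebesgue. summable (\<lambda>j. dyadic_piece \<sigma> N j f x)" if "f \<in> L2" for f
    by (rule L2_series(1)[OF meas r BB piece[OF that]])
  have Tn: "(\<integral>\<^sup>+x. ennreal ((cmod (T f x))\<^sup>2) \<partial>lebesgue) \<le> ennreal (B * (L2_norm f)\<^sup>2 / (1 - r)\<^sup>2)" if "f \<in> L2" for f
    unfolding T_def by (rule L2_series(2)[OF meas r BB piece[OF that]])
  have Tm [measurable]: "T f \<in> borel_measurable lebesgue" for f
    unfolding T_def[abs_def] by measurable
  have Ti: "integrable lebesgue (\<lambda>x. (cmod (T f x))\<^sup>2)" if "f \<in> L2" for f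
    using Tn[OF that] by (intro integrableI_bounded) (auto intro: le_less_trans)
  have "T f \<in> L2" if "f \<in> L2" for f
    using Ti[OF that] Tm by (simp add: L2_def)
  moreover have "AE x in lebesgue. T (\<lambda>y. f y + g y) x = T f x + T g x" if "f \<in> L2" "g \<in> L2" for f g
    using conv[OF that(1)] conv[OF that(2)]
    by eventually_elim (simp add: T_def dyadic_piece_add that suminf_add)
  moreover have "AE x in lebesgue. T (\<lambda>y. c * f y) x = c * T f x" if "f \<in> L2" for c f
    using conv[OF that] by eventually_elim (simp add: T_def dyadic_piece_cmult suminf_mult)
  moreover have "L2_norm (T f) \<le> (sqrt B / (1 - r)) * L2_norm f" if f: "f \<in> L2" for f
  proof -
    have "ennreal (LINT x|lebesgue. (cmod (T f x))\<^sup>2) \<le> ennreal (B * (L2_norm f)\<^sup>2 / (1 - r)\<^sup>2)"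
      using Tn[OF f] by (subst nn_integral_eq_integral[symmetric]) (use Ti[OF f] in auto)
    then have "(LINT x|lebesgue. (cmod (T f x))\<^sup>2) \<le> B * (L2_norm f)\<^sup>2 / (1 - r)\<^sup>2"
      using B by (subst (asm) ennreal_le_iff) auto
    then have "L2_norm (T f) \<le> sqrt (B * (L2_norm f)\<^sup>2 / (1 - r)\<^sup>2)"
      unfolding L2_norm_def[of "T f"] by (rule real_sqrt_le_mono)
    also have "\<dots> = (sqrt B / (1 - r)) * L2_norm f"
      using r by (simp add: real_sqrt_mult real_sqrt_divide L2_norm_def)
    finally show ?thesis .
  qed
  ultimately have "bounded_operator_L2 T"
    unfolding bounded_operator_L2_def by blast
  moreover have "T f x = pseudo_mult \<sigma> f x" if "f \<in> hermite_span" for f x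
    unfolding T_def by (rule sums_unique[symmetric, OF dyadic_piece_sums_on_span[OF that]])
  ultimately show ?thesis
    unfolding extends_to_bounded_operator_L2_def by auto
qed

end
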